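(* Let $n\ge 2$, let $\sigma\ge 0$, let $z\in\mathbb{C}^n$ satisfy $|z_1|=\cdots=|z_n|=1$, let $W\in\mathbb{C}^{n\times n}$ be a Hermitian Gaussian Wigner matrix, and let $C=zz^*+\sigma W$. With probability at least $1-\mathcal{O}(n^{-5/4})$, the following holds for every global optimizer $x$ of the problem \[\max_{x\in\mathbb{C}^n} x^*Cx \quad\text{subject to } |x_1|=\cdots=|x_n|=1\] whose global phase is fixed so that $z^*x=|z^*x|$: \[\|x-z\|_\infty\le 6\left(\sqrt{\log n}+29\sigma\right)\sigma n^{-1/2},\qquad \|x-z\|_2\le 12\sigma;\] and furthermore, if $\sigma\le \frac{1}{18}n^{1/4}$, then the semidefinite program \[\max_{X\in\mathbb{C}^{n\times n}} \operatorname{tr}(CX)\quad\text{subject to } \operatorname{diag}(X)=\mathbf{1},\ X\succeq 0\] has the rank-one matrix $X=xx^*$ as its unique solution.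
   Context: A Hermitian Gaussian Wigner matrix $W$ is a random Hermitian matrix with $W_{ii}=0$ for all $i$, whose entries $W_{ij}$, $i<j$, are i.i.d. standard complex normal random variables ($\mathbb{E}W_{ij}=0$, $\mathbb{E}|W_{ij}|^2=1$, uniformly random phase), and $W_{ji}=\overline{W_{ij}}$. Here $\mathbf{1}$ is the all-ones vector, $\operatorname{diag}(X)$ is the vector of diagonal entries of $X$, $X\succeq 0$ means Hermitian positive semidefinite, $\|v\|_\infty=\max_i|v_i|$, and $\log$ is the natural logarithm. $z$ is deterministic. *)

theory Defs
  imports "HOL-Probability.Probability"
begin

text \<open>Vectors in C^n and n x n matrices are represented by functions on nat,
  only indices below n are relevant.\<close>

text \<open>Standard complex normal law: density exp(-|w|^2)/pi w.r.t. Lebesgue measure on C = R^2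
  (mean 0, E|w|^2 = 1, uniformly random phase).\<close>
definition std_complex_normal :: "complex measure" where
  "std_complex_normal = density lborel (\<lambda>w. ennreal (exp (- (cmod w)\<^sup>2) / pi))"

definition wigner_entries :: "nat \<Rightarrow> (nat \<times> nat \<Rightarrow> complex) measure" where
  "wigner_entries n = PiM {(i, j). i < j \<and> j < n} (\<lambda>_. std_complex_normal)"

definition wigner_matrix :: "(nat \<times> nat \<Rightarrow> complex) \<Rightarrow> nat \<Rightarrow> nat \<Rightarrow> complex" where
  "wigner_matrix w i j = (if i < j then w (i, j) else if j < i then cnj (w (j, i)) else 0)"

definition unimod :: "nat \<Rightarrow> (nat \<Rightarrow> complex) \<Rightarrow> bool" where
  "unimod n x \<longleftrightarrow> (\<forall>i<n. cmod (x i) = 1)"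

definition qform :: "nat \<Rightarrow> (nat \<Rightarrow> nat \<Rightarrow> complex) \<Rightarrow> (nat \<Rightarrow> complex) \<Rightarrow> complex" where
  "qform n C x = (\<Sum>i<n. \<Sum>j<n. cnj (x i) * C i j * x j)"

definition cinner :: "nat \<Rightarrow> (nat \<Rightarrow> complex) \<Rightarrow> (nat \<Rightarrow> complex) \<Rightarrow> complex" where
  "cinner n u v = (\<Sum>i<n. cnj (u i) * v i)"

text \<open>x is a global optimizer of max x^*Cx s.t. |x_1| = ... = |x_n| = 1
  (x^*Cx is real since C is Hermitian).\<close>
definition is_global_opt :: "nat \<Rightarrow> (nat \<Rightarrow> nat \<Rightarrow> complex) \<Rightarrow> (nat \<Rightarrow> complex) \<Rightarrow> bool" where
  "is_global_opt n C x \<longleftrightarrow> unimod n x \<and>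
     (\<forall>y. unimod n y \<longrightarrow> Re (qform n C y) \<le> Re (qform n C x))"

definition hermitian_mat :: "nat \<Rightarrow> (nat \<Rightarrow> nat \<Rightarrow> complex) \<Rightarrow> bool" where
  "hermitian_mat n X \<longleftrightarrow> (\<forall>i<n. \<forall>j<n. X j i = cnj (X i j))"

definition psd_mat :: "nat \<Rightarrow> (nat \<Rightarrow> nat \<Rightarrow> complex) \<Rightarrow> bool" where
  "psd_mat n X \<longleftrightarrow> hermitian_mat n X \<and>
     (\<forall>v. Im (qform n X v) = 0 \<and> 0 \<le> Re (qform n X v))"

definition trace_prod :: "nat \<Rightarrow> (nat \<Rightarrow> nat \<Rightarrow> complex) \<Rightarrow> (nat \<Rightarrow> nat \<Rightarrow> complex) \<Rightarrow> complex" where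
  "trace_prod n C X = (\<Sum>i<n. \<Sum>j<n. C i j * X j i)"

definition sdp_feasible :: "nat \<Rightarrow> (nat \<Rightarrow> nat \<Rightarrow> complex) \<Rightarrow> bool" where
  "sdp_feasible n X \<longleftrightarrow> (\<forall>i<n. X i i = 1) \<and> psd_mat n X"

text \<open>X is the unique solution of max tr(CX) s.t. diag(X) = 1, X psd
  (tr(CX) is real for Hermitian C and X).\<close>
definition sdp_unique_solution :: "nat \<Rightarrow> (nat \<Rightarrow> nat \<Rightarrow> complex) \<Rightarrow> (nat \<Rightarrow> nat \<Rightarrow> complex) \<Rightarrow> bool" where
  "sdp_unique_solution n C X \<longleftrightarrow> sdp_feasible n X \<and>
     (\<forall>Y. sdp_feasible n Y \<longrightarrow> Re (trace_prod n C X) \<le> Re (trace_prod n C Y) \<longrightarrow>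
          (\<forall>i<n. \<forall>j<n. Y i j = X i j))"

end

theory Submission
  imports Defs
begin

text \<open>The noise enters only through two events: \<open>\<bar>v\<^sup>* W v\<bar> \<le> 4 \<surd>n \<parallel>v\<parallel>\<^sup>2\<close> for all \<open>v\<close>, and
  \<open>\<parallel>W z\<parallel>\<^sub>\<infinity> \<le> 5/2 \<surd>(n log n)\<close>. The second is a Chernoff bound. For the first, let \<open>g\<close> be a standard
  complex Gaussian vector independent of \<open>W\<close> and put
  \<open>Z(W) = E\<^sub>g exp (t g\<^sup>* W g - t\<^sup>2 \<Sum>\<^sub>i\<^sub><\<^sub>j \<bar>g\<^sub>i\<bar>\<^sup>2 \<bar>g\<^sub>j\<bar>\<^sup>2)\<close>. Integrating over \<open>W\<close> first gives \<open>E Z = 1\<close>. Substituting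
  \<open>g \<mapsto> m + g / \<surd>2\<close> with \<open>\<parallel>m\<parallel>\<^sup>2 = n/2\<close> and applying Jensen's inequality gives
  \<open>Z(W) \<ge> exp (t m\<^sup>* W m - t\<^sup>2 n\<^sup>2 / 2 - n log 2)\<close>, because \<open>W\<close> has zero diagonal. Hence a large quadratic
  form in any direction \<open>m\<close> makes \<open>Z(W) \<ge> e\<^sup>n\<close> for \<open>t = \<plusminus>2 / \<surd>n\<close>, which Markov's inequality excludes.

  On these events the error bounds follow from comparing the objective at \<open>x\<close> and \<open>z\<close> and from the
  stationarity condition \<open>C x = diag \<mu> x\<close> with \<open>\<mu>\<^sub>i = \<bar>(C x)\<^sub>i\<bar>\<close>; the matrix \<open>diag \<mu> - C\<close> is a dual certificate for
  the semidefinite program. Dimensions below 100 are absorbed in the constant.\<close>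

section \<open>The standard complex normal law\<close>

lemma sets_std_complex_normal [simp, measurable_cong]: "sets std_complex_normal = sets borel"
  by (simp add: std_complex_normal_def)

lemma space_std_complex_normal [simp]: "space std_complex_normal = UNIV"
  by (simp add: std_complex_normal_def)

lemma nn_integral_std_complex_normal:
  assumes [measurable]: "f \<in> borel_measurable borel"
  shows "(\<integral>\<^sup>+w. f w \<partial>std_complex_normal) = (\<integral>\<^sup>+w. ennreal (exp (- (cmod w)\<^sup>2) / pi) * f w \<partial>lborel)"
  unfolding std_complex_normal_def by (subst nn_integral_density) auto

lemma nn_integral_lborel_complex_prod:
  fixes f g :: "real \<Rightarrow> real"
  assumes [measurable]: "f \<in> borel_measurable borel" "g \<in> borel_measurable borel"
    and nonneg: "\<And>x. 0 \<le> f x" "\<And>x. 0 \<le> g x"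
  shows "(\<integral>\<^sup>+w. ennreal (f (Re w) * g (Im w)) \<partial>lborel) = (\<integral>\<^sup>+x. f x \<partial>lborel) * (\<integral>\<^sup>+x. g x \<partial>lborel)"
proof -
  have "(\<integral>\<^sup>+w. (\<Prod>b\<in>Basis. ennreal (if b = 1 then f ((w::complex) \<bullet> b) else g (w \<bullet> b))) \<partial>lborel)
      = (\<Prod>b\<in>(Basis::complex set). (\<integral>\<^sup>+x. ennreal (if b = 1 then f x else g x) \<partial>lborel))"
    by (rule nn_integral_lborel_prod[where f="\<lambda>b x. ennreal (if b = 1 then f x else g x)"]) auto
  then show ?thesis
    by (simp add: Basis_complex_def ennreal_mult nonneg)
qed

text \<open>Real and imaginary parts are independent centred normals of variance 1/2, so integrals
  over the plane split into real Gaussian ones.\<close>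

lemma std_complex_density_eq:
  "exp (- (cmod w)\<^sup>2) / pi = normal_density 0 (1 / sqrt 2) (Re w) * normal_density 0 (1 / sqrt 2) (Im w)"
  by (simp add: normal_density_def power_divide cmod_power2 exp_add[symmetric])

interpretation std_complex_normal: prob_space std_complex_normal
proof
  have "emeasure std_complex_normal UNIV = (\<integral>\<^sup>+w. 1 \<partial>std_complex_normal)"
    by simp
  also have "\<dots> = (\<integral>\<^sup>+x. normal_density 0 (1 / sqrt 2) x \<partial>lborel) * (\<integral>\<^sup>+x. normal_density 0 (1 / sqrt 2) x \<partial>lborel)"
    by (simp only: nn_integral_std_complex_normal std_complex_density_eq mult_1_right borel_measurable_const)
       (rule nn_integral_lborel_complex_prod, auto)
  also have "\<dots> = 1"
    by (simp add: nn_integral_eq_integral)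
  finally show "emeasure std_complex_normal (space std_complex_normal) = 1" by simp
qed

lemma nn_integral_std_complex_normal_norm_square:
  "(\<integral>\<^sup>+w. ennreal ((cmod w)\<^sup>2) \<partial>std_complex_normal) = 1"
proof -
  let ?f = "normal_density 0 (1 / sqrt 2)"
  have m: "has_bochner_integral lborel (\<lambda>x. ?f x * x\<^sup>2) (1/2)"
    using normal_moment_even[of "1 / sqrt 2" 0 1] by (simp add: power_divide)
  have m': "(\<integral>\<^sup>+x. ennreal (?f x * x\<^sup>2) \<partial>lborel) = ennreal (1/2)"
    using m by (intro nn_integral_eq_integral[THEN trans] arg_cong[where f=ennreal])
      (auto simp: has_bochner_integral_iff simp del: ennreal_half)
  have f1: "(\<integral>\<^sup>+x. ennreal (?f x) \<partial>lborel) = 1"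
    by (simp add: nn_integral_eq_integral)
  have "(\<integral>\<^sup>+w. ennreal ((cmod w)\<^sup>2) \<partial>std_complex_normal)
      = (\<integral>\<^sup>+w. ennreal ((?f (Re w) * (Re w)\<^sup>2) * ?f (Im w)) + ennreal (?f (Re w) * (?f (Im w) * (Im w)\<^sup>2)) \<partial>lborel)"
    by (subst nn_integral_std_complex_normal, simp, intro nn_integral_cong, subst std_complex_density_eq)
       (simp add: cmod_power2 ennreal_mult[symmetric] ennreal_plus[symmetric] algebra_simps del: ennreal_plus)
  also have "\<dots> = ennreal (1/2) + ennreal (1/2)"
    using nn_integral_lborel_complex_prod[of "\<lambda>x. ?f x * x\<^sup>2" ?f]
      nn_integral_lborel_complex_prod[of ?f "\<lambda>x. ?f x * x\<^sup>2"]
    by (subst nn_integral_add) (auto simp: m' f1)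
  also have "\<dots> = ennreal (1/2 + 1/2)"
    by (rule ennreal_plus[symmetric]) auto
  also have "\<dots> = 1"
    by (simp only: field_sum_of_halves ennreal_1)
  finally show ?thesis .
qed

text \<open>Change of variables: \<open>\<rho>\<^sup>2\<close> is the Jacobian in real dimension two
  and the exponential is the ratio of the densities at the new and the old point. Factor 1 yields
  the moment generating function, factor -1 the symmetry of the law, and factor 1 / sqrt 2 the shift
  of the Gaussian directions.\<close>

lemma std_complex_normal_affine:
  fixes \<rho> :: real
  assumes [measurable]: "f \<in> borel_measurable borel" and "\<rho> \<noteq> 0"
  shows "(\<integral>\<^sup>+w. f w \<partial>std_complex_normal)
    = (\<integral>\<^sup>+w. ennreal (\<rho>\<^sup>2 * exp ((cmod w)\<^sup>2 - (cmod (m + \<rho> *\<^sub>R w))\<^sup>2)) * f (m + \<rho> *\<^sub>R w) \<partial>std_complex_normal)"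
proof -
  have "(\<integral>\<^sup>+w. f w \<partial>std_complex_normal) = (\<integral>\<^sup>+w. ennreal (exp (- (cmod w)\<^sup>2) / pi) * f w \<partial>lborel)"
    by (simp add: nn_integral_std_complex_normal)
  also have "\<dots> = (\<integral>\<^sup>+w. ennreal (\<rho>\<^sup>2) * (ennreal (exp (- (cmod (m + \<rho> *\<^sub>R w))\<^sup>2) / pi) * f (m + \<rho> *\<^sub>R w)) \<partial>lborel)"
    using assms(2) by (subst lborel_affine[of \<rho> m]) (auto simp: nn_integral_density nn_integral_distr)
  also have "\<dots> = (\<integral>\<^sup>+w. ennreal (exp (- (cmod w)\<^sup>2) / pi) * (ennreal (\<rho>\<^sup>2 * exp ((cmod w)\<^sup>2 - (cmod (m + \<rho> *\<^sub>R w))\<^sup>2)) * f (m + \<rho> *\<^sub>R w)) \<partial>lborel)"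
    by (intro nn_integral_cong)
       (simp add: ennreal_mult[symmetric] mult.assoc[symmetric] exp_diff exp_minus, simp add: divide_inverse mult_ac)
  also have "\<dots> = (\<integral>\<^sup>+w. ennreal (\<rho>\<^sup>2 * exp ((cmod w)\<^sup>2 - (cmod (m + \<rho> *\<^sub>R w))\<^sup>2)) * f (m + \<rho> *\<^sub>R w) \<partial>std_complex_normal)"
    by (subst nn_integral_std_complex_normal) auto
  finally show ?thesis .
qed

text \<open>Shifting the constant function 1 by \<open>- cnj c\<close> completes the square: the
  density ratio becomes \<open>exp (2 * Re (c * w) - (cmod c)\<^sup>2)\<close>, which therefore has
  integral 1.\<close>

lemma std_complex_normal_mgf:
  "(\<integral>\<^sup>+w. ennreal (exp (2 * Re (c * w))) \<partial>std_complex_normal) = ennreal (exp ((cmod c)\<^sup>2))"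
proof -
  have *: "(cmod w)\<^sup>2 - (cmod (- cnj c + 1 *\<^sub>R w))\<^sup>2 = 2 * Re (c * w) - (cmod c)\<^sup>2" for w
    unfolding cmod_power2 by (simp add: power2_eq_square algebra_simps)
  have "1 = (\<integral>\<^sup>+w. 1 \<partial>std_complex_normal)"
    by (simp add: std_complex_normal.emeasure_space_1[simplified])
  also have "\<dots> = (\<integral>\<^sup>+w. ennreal (exp (- (cmod c)\<^sup>2)) * ennreal (exp (2 * Re (c * w))) \<partial>std_complex_normal)"
    by (subst std_complex_normal_affine[of _ 1 "- cnj c"])
       (auto simp only: * ennreal_mult[symmetric] exp_ge_zero exp_add[symmetric] mult_1_right power_one
         mult_1_left intro!: nn_integral_cong borel_measurable_const, simp)
  also have "\<dots> = ennreal (exp (- (cmod c)\<^sup>2)) * (\<integral>\<^sup>+w. ennreal (exp (2 * Re (c * w))) \<partial>std_complex_normal)"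
    by (subst nn_integral_cmult) auto
  finally have 1: "1 = ennreal (exp (- (cmod c)\<^sup>2)) * (\<integral>\<^sup>+w. ennreal (exp (2 * Re (c * w))) \<partial>std_complex_normal)" .
  have "ennreal (exp ((cmod c)\<^sup>2)) = ennreal (exp ((cmod c)\<^sup>2)) * 1" by simp
  also have "\<dots> = ennreal (exp ((cmod c)\<^sup>2)) * ennreal (exp (- (cmod c)\<^sup>2)) * (\<integral>\<^sup>+w. ennreal (exp (2 * Re (c * w))) \<partial>std_complex_normal)"
    by (subst 1) (simp add: mult.assoc)
  also have "ennreal (exp ((cmod c)\<^sup>2)) * ennreal (exp (- (cmod c)\<^sup>2)) = 1"
    by (simp add: ennreal_mult[symmetric] exp_add[symmetric])
  finally show ?thesis by simp
qed

lemma has_bochner_integral_std_complex_normal_norm_square: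
  "has_bochner_integral std_complex_normal (\<lambda>w. (cmod w)\<^sup>2) 1"
  by (rule has_bochner_integral_nn_integral) (auto simp: nn_integral_std_complex_normal_norm_square)

lemma integrable_std_complex_normal_id: "integrable std_complex_normal (\<lambda>w. w)"
proof (rule Bochner_Integration.integrable_bound)
  show "integrable std_complex_normal (\<lambda>w. 1 + (cmod w)\<^sup>2)"
    using has_bochner_integral_std_complex_normal_norm_square by (auto simp: has_bochner_integral_iff)
  have "x \<le> 1 + x\<^sup>2" for x :: real
    using sum_squares_bound[of x 1] by (smt (verit) power_one zero_le_power2 mult_1_right)
  then show "AE w in std_complex_normal. norm w \<le> norm (1 + (cmod w)\<^sup>2)"
    by (auto intro!: AE_I2 simp: abs_of_nonneg add_nonneg_nonneg)
qed auto

text \<open>The law is invariant under negation, by the affine rule with factor -1 and shift 0, so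
  the mean equals its own negative.\<close>

lemma integral_std_complex_normal_id: "(\<integral>w. w \<partial>std_complex_normal) = 0"
proof -
  have "distr std_complex_normal borel uminus = std_complex_normal"
  proof (rule measure_eqI)
    fix A :: "complex set" assume "A \<in> sets (distr std_complex_normal borel uminus)"
    then have [measurable]: "A \<in> sets borel" by simp
    have "emeasure std_complex_normal A = (\<integral>\<^sup>+w. indicator A w \<partial>std_complex_normal)"
      by simp
    also have "\<dots> = (\<integral>\<^sup>+w. indicator A (- w) \<partial>std_complex_normal)"
      by (subst std_complex_normal_affine[of _ "-1" 0]) auto
    also have "\<dots> = emeasure (distr std_complex_normal borel uminus) A"
      by (subst nn_integral_indicator[symmetric], simp, subst nn_integral_distr) auto
    finally show "emeasure (distr std_complex_normal borel uminus) A = emeasure std_complex_normal A" ..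
  qed simp
  then have "(\<integral>w. w \<partial>std_complex_normal) = (\<integral>w. w \<partial>distr std_complex_normal borel uminus)"
    by simp
  also have "\<dots> = - (\<integral>w. w \<partial>std_complex_normal)"
    by (subst integral_distr) auto
  finally show ?thesis by simp
qed

section \<open>Products of standard complex normal laws\<close>

interpretation std_complex_normal_product: product_prob_space "\<lambda>_. std_complex_normal" I for I :: "'i set"
  by standard

text \<open>The product law is the image under \<open>T\<close> of its own reweighting by
  \<open>h\<close>. This is checked on boxes, where both measures factor and the one-dimensional
  rule applies. The map is restricted to \<open>I\<close> because points of the product space are
  extensional.\<close>

lemma nn_integral_PiM_std_complex_normal_affine:
  fixes \<rho> :: real and I :: "'i set"
  assumes I: "finite I" and \<rho>: "\<rho> \<noteq> 0"
    and f: "f \<in> borel_measurable (PiM I (\<lambda>_. std_complex_normal))"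
  shows "(\<integral>\<^sup>+g. f g \<partial>PiM I (\<lambda>_. std_complex_normal))
    = (\<integral>\<^sup>+g. (\<Prod>i\<in>I. ennreal (\<rho>\<^sup>2 * exp ((cmod (g i))\<^sup>2 - (cmod (m i + \<rho> *\<^sub>R g i))\<^sup>2)))
           * f (\<lambda>i\<in>I. m i + \<rho> *\<^sub>R g i) \<partial>PiM I (\<lambda>_. std_complex_normal))"
proof -
  note f[measurable]
  define h where "h g = (\<Prod>i\<in>I. ennreal (\<rho>\<^sup>2 * exp ((cmod (g i))\<^sup>2 - (cmod (m i + \<rho> *\<^sub>R g i))\<^sup>2)))" for g
  define T where "T g = (\<lambda>i\<in>I. m i + \<rho> *\<^sub>R g i)" for g :: "'i \<Rightarrow> complex"
  let ?P = "PiM I (\<lambda>_. std_complex_normal)"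
  have [measurable]: "h \<in> borel_measurable ?P"
    unfolding h_def by measurable
  have [measurable]: "T \<in> measurable ?P ?P"
    unfolding T_def by measurable
  have "?P = distr (density ?P h) ?P T"
  proof (rule std_complex_normal_product.PiM_eqI[OF I, symmetric])
    fix A assume A: "\<And>i. i \<in> I \<Longrightarrow> A i \<in> sets std_complex_normal"
    then have A'[measurable]: "A i \<in> sets borel" if "i \<in> I" for i
      using that by auto
    have [measurable]: "Pi\<^sub>E I A \<in> sets ?P"
      using A I by (intro sets_PiM_I_finite) auto
    have "emeasure (distr (density ?P h) ?P T) (Pi\<^sub>E I A) = (\<integral>\<^sup>+g. h g * indicator (Pi\<^sub>E I A) (T g) \<partial>?P)"
      by (subst nn_integral_indicator[symmetric], simp, subst nn_integral_distr, simp, simp,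
          subst nn_integral_density) auto
    also have "\<dots> = (\<integral>\<^sup>+g. (\<Prod>i\<in>I. ennreal (\<rho>\<^sup>2 * exp ((cmod (g i))\<^sup>2 - (cmod (m i + \<rho> *\<^sub>R g i))\<^sup>2))
         * indicator (A i) (m i + \<rho> *\<^sub>R g i)) \<partial>?P)"
    proof (rule nn_integral_cong)
      fix g :: "'i \<Rightarrow> complex"
      have "indicator (Pi\<^sub>E I A) (T g) = (\<Prod>i\<in>I. indicator (A i) (m i + \<rho> *\<^sub>R g i) :: ennreal)"
        using I by (auto simp: T_def indicator_def PiE_iff prod_zero_iff)
      then show "h g * indicator (Pi\<^sub>E I A) (T g) = (\<Prod>i\<in>I. ennreal (\<rho>\<^sup>2 * exp ((cmod (g i))\<^sup>2 - (cmod (m i + \<rho> *\<^sub>R g i))\<^sup>2))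
         * indicator (A i) (m i + \<rho> *\<^sub>R g i))"
        by (simp add: h_def prod.distrib)
    qed
    also have "\<dots> = (\<Prod>i\<in>I. \<integral>\<^sup>+w. ennreal (\<rho>\<^sup>2 * exp ((cmod w)\<^sup>2 - (cmod (m i + \<rho> *\<^sub>R w))\<^sup>2))
         * indicator (A i) (m i + \<rho> *\<^sub>R w) \<partial>std_complex_normal)"
      using I by (intro std_complex_normal_product.product_nn_integral_prod) auto
    also have "\<dots> = (\<Prod>i\<in>I. emeasure std_complex_normal (A i))"
      using \<rho> by (intro prod.cong refl, subst std_complex_normal_affine[symmetric]) auto
    finally show "emeasure (distr (density ?P h) ?P T) (Pi\<^sub>E I A) = (\<Prod>i\<in>I. emeasure std_complex_normal (A i))" .
  qed (auto)
  then have "(\<integral>\<^sup>+g. f g \<partial>?P) = (\<integral>\<^sup>+g. f g \<partial>distr (density ?P h) ?P T)"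
    by simp
  also have "\<dots> = (\<integral>\<^sup>+g. h g * f (T g) \<partial>?P)"
    by (subst nn_integral_distr, simp, simp, subst nn_integral_density) auto
  finally show ?thesis
    by (simp add: h_def T_def)
qed

lemma PiM_std_complex_normal_mgf:
  assumes I: "finite I"
  shows "(\<integral>\<^sup>+w. ennreal (exp (\<Sum>i\<in>I. 2 * Re (c i * w i))) \<partial>PiM I (\<lambda>_. std_complex_normal))
    = ennreal (exp (\<Sum>i\<in>I. (cmod (c i))\<^sup>2))"
proof -
  have "(\<integral>\<^sup>+w. ennreal (exp (\<Sum>i\<in>I. 2 * Re (c i * w i))) \<partial>PiM I (\<lambda>_. std_complex_normal))
     = (\<integral>\<^sup>+w. (\<Prod>i\<in>I. ennreal (exp (2 * Re (c i * w i)))) \<partial>PiM I (\<lambda>_. std_complex_normal))"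
    using I by (simp add: exp_sum prod_ennreal)
  also have "\<dots> = (\<Prod>i\<in>I. \<integral>\<^sup>+w. ennreal (exp (2 * Re (c i * w))) \<partial>std_complex_normal)"
    using I by (intro std_complex_normal_product.product_nn_integral_prod) auto
  also have "\<dots> = ennreal (exp (\<Sum>i\<in>I. (cmod (c i))\<^sup>2))"
    using I by (simp only: std_complex_normal_mgf exp_sum prod_ennreal exp_ge_zero)
  finally show ?thesis .
qed

lemma has_bochner_integral_PiM_component:
  fixes f :: "complex \<Rightarrow> 'b::{banach, second_countable_topology}"
  assumes "finite I" "i \<in> I" "has_bochner_integral std_complex_normal f a"
  shows "has_bochner_integral (PiM I (\<lambda>_. std_complex_normal)) (\<lambda>g. f (g i)) a"
proof -
  let ?P = "PiM I (\<lambda>_. std_complex_normal)"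
  have d: "distr ?P std_complex_normal (\<lambda>g. g i) = std_complex_normal"
    using assms by (intro std_complex_normal_product.PiM_component)
  have m: "(\<lambda>g. g i) \<in> measurable ?P std_complex_normal"
    using assms by (intro measurable_component_singleton)
  have f: "f \<in> borel_measurable std_complex_normal"
    using assms by (auto simp: has_bochner_integral_iff)
  have "has_bochner_integral (distr ?P std_complex_normal (\<lambda>g. g i)) f a"
    using assms by (simp add: d)
  then show ?thesis
    unfolding has_bochner_integral_iff
    using integrable_distr_eq[OF m f] integral_distr[OF m f] by simp
qed

text \<open>Independence of two coordinates, obtained from the product formula over all of
  \<open>I\<close> with the constant factor 1 at every other index.\<close>

lemma has_bochner_integral_PiM_mult_components:
  fixes f h :: "complex \<Rightarrow> 'b::{real_normed_field, banach, second_countable_topology}"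
  assumes I: "finite I" "i \<in> I" "j \<in> I" "i \<noteq> j"
    and f: "has_bochner_integral std_complex_normal f a"
    and h: "has_bochner_integral std_complex_normal h b"
  shows "has_bochner_integral (PiM I (\<lambda>_. std_complex_normal)) (\<lambda>g. f (g i) * h (g j)) (a * b)"
proof -
  define F where "F k = (if k = i then f else if k = j then h else (\<lambda>_. 1))" for k
  have int: "integrable std_complex_normal (F k)" for k
    using f h by (auto simp: F_def has_bochner_integral_iff)
  have split: "(\<Prod>k\<in>I. G k) = G i * G j" if "\<And>k. k \<noteq> i \<Longrightarrow> k \<noteq> j \<Longrightarrow> G k = 1" for G :: "_ \<Rightarrow> 'b"
  proof -
    have "(\<Prod>k\<in>I. G k) = (\<Prod>k\<in>{i, j}. G k)"
      using I that by (intro prod.mono_neutral_right) auto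
    then show ?thesis using I by simp
  qed
  have 1: "(\<Prod>k\<in>I. F k (g k)) = f (g i) * h (g j)" for g
    using I by (subst split) (auto simp: F_def)
  have 2: "(\<Prod>k\<in>I. integral\<^sup>L std_complex_normal (F k)) = a * b"
    using I f h std_complex_normal.prob_space by (subst split) (simp_all add: F_def has_bochner_integral_iff)
  show ?thesis
    using std_complex_normal_product.product_integrable_prod[of I F, OF I(1) int]
      std_complex_normal_product.product_integral_prod[of I F, OF I(1) int]
    unfolding 1 2 by (simp add: has_bochner_integral_iff)
qed

text \<open>Jensen's inequality for the exponential. The extended integral on the right either is
  infinite, a trivial case, or makes \<open>exp (H x)\<close> integrable.\<close>

lemma (in prob_space) exp_expectation_le_nn_integral:
  fixes H :: "'a \<Rightarrow> real"
  assumes "has_bochner_integral M H a"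
  shows "ennreal (exp a) \<le> (\<integral>\<^sup>+x. ennreal (exp (H x)) \<partial>M)"
proof (cases "(\<integral>\<^sup>+x. ennreal (exp (H x)) \<partial>M) = \<infinity>")
  case False
  have H: "integrable M H" "expectation H = a"
    using assms by (auto simp: has_bochner_integral_iff)
  have int: "integrable M (\<lambda>x. exp (H x))"
    using False H(1) by (intro integrableI_nonneg) (auto simp: top.not_eq_extremum)
  have "exp (expectation H) \<le> expectation (\<lambda>x. exp (H x))"
    using H(1) int by (intro jensens_inequality[where I=UNIV]) (auto intro: exp_convex)
  then show ?thesis
    using int H by (simp add: nn_integral_eq_integral)
qed auto

section \<open>Exponential average over Gaussian directions\<close>

definition index_pairs :: "nat \<Rightarrow> (nat \<times> nat) set" where
  "index_pairs n = {(i, j). i < j \<and> j < n}"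

lemma finite_index_pairs [simp]: "finite (index_pairs n)"
  by (rule finite_subset[of _ "{..<n} \<times> {..<n}"]) (auto simp: index_pairs_def)

lemma index_pairs_bounds: "p \<in> index_pairs n \<Longrightarrow> fst p < snd p \<and> fst p < n \<and> snd p < n"
  by (auto simp: index_pairs_def)

lemma sum_square_eq_index_pairs:
  fixes f :: "nat \<Rightarrow> nat \<Rightarrow> 'a::comm_monoid_add"
  shows "(\<Sum>i<n. \<Sum>j<n. f i j) = (\<Sum>(i, j)\<in>index_pairs n. f i j + f j i) + (\<Sum>i<n. f i i)"
proof (induction n)
  case 0
  then show ?case by (simp add: index_pairs_def)
next
  case (Suc n)
  have eq: "index_pairs (Suc n) = index_pairs n \<union> (\<lambda>i. (i, n)) ` {..<n}"
    by (auto simp: index_pairs_def less_Suc_eq)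
  have disj: "index_pairs n \<inter> (\<lambda>i. (i, n)) ` {..<n} = {}"
    by (auto simp: index_pairs_def)
  have "(\<Sum>(i, j)\<in>index_pairs (Suc n). f i j + f j i)
      = (\<Sum>(i, j)\<in>index_pairs n. f i j + f j i) + (\<Sum>i<n. f i n + f n i)"
    unfolding eq using disj by (subst sum.union_disjoint) (auto simp: sum.reindex inj_on_def)
  then show ?case
    using Suc by (simp add: sum.distrib add_ac)
qed

lemma wigner_entries_eq: "wigner_entries n = PiM (index_pairs n) (\<lambda>_. std_complex_normal)"
  by (simp add: wigner_entries_def index_pairs_def)

definition gauss_vectors :: "nat \<Rightarrow> (nat \<Rightarrow> complex) measure" where
  "gauss_vectors n = PiM {..<n} (\<lambda>_. std_complex_normal)"

text \<open>The value u^* W u as a real number, written through the independent entries above the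
  diagonal so that it is visibly linear in them.\<close>

definition wigner_form :: "nat \<Rightarrow> (nat \<times> nat \<Rightarrow> complex) \<Rightarrow> (nat \<Rightarrow> complex) \<Rightarrow> real" where
  "wigner_form n w u = (\<Sum>p\<in>index_pairs n. 2 * Re (cnj (u (fst p)) * w p * u (snd p)))"

text \<open>\<open>t\<^sup>2 * pair_energy n u\<close> is the logarithm of the expectation over
  \<open>w\<close> of \<open>exp (t * wigner_form n w u)\<close>.\<close>

definition pair_energy :: "nat \<Rightarrow> (nat \<Rightarrow> complex) \<Rightarrow> real" where
  "pair_energy n u = (\<Sum>p\<in>index_pairs n. (cmod (u (fst p)))\<^sup>2 * (cmod (u (snd p)))\<^sup>2)"

lemma qform_wigner_matrix:
  "qform n (wigner_matrix w) u = complex_of_real (wigner_form n w u)"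
proof -
  have "qform n (wigner_matrix w) u = (\<Sum>(i, j)\<in>index_pairs n. cnj (u i) * wigner_matrix w i j * u j
       + cnj (u j) * wigner_matrix w j i * u i)"
    unfolding qform_def by (subst sum_square_eq_index_pairs) (simp add: wigner_matrix_def)
  also have "\<dots> = (\<Sum>p\<in>index_pairs n. complex_of_real (2 * Re (cnj (u (fst p)) * w p * u (snd p))))"
    by (rule sum.cong) (auto simp: index_pairs_def wigner_matrix_def complex_eq_iff algebra_simps)
  finally show ?thesis by (simp add: wigner_form_def)
qed

lemma wigner_form_cong: "(\<And>i. i < n \<Longrightarrow> u i = v i) \<Longrightarrow> wigner_form n w u = wigner_form n w v"
  unfolding wigner_form_def by (intro sum.cong refl) (auto dest!: index_pairs_bounds)

lemma pair_energy_cong: "(\<And>i. i < n \<Longrightarrow> u i = v i) \<Longrightarrow> pair_energy n u = pair_energy n v"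
  unfolding pair_energy_def by (intro sum.cong refl) (auto dest!: index_pairs_bounds)

text \<open>The quantity Z(W) of the introduction, taken in \<open>ennreal\<close> so that its
  finiteness is not presupposed.\<close>

definition exp_average :: "nat \<Rightarrow> real \<Rightarrow> (nat \<times> nat \<Rightarrow> complex) \<Rightarrow> ennreal" where
  "exp_average n t w = (\<integral>\<^sup>+g. ennreal (exp (t * wigner_form n w g - t\<^sup>2 * pair_energy n g)) \<partial>gauss_vectors n)"

lemma prob_space_wigner_entries: "prob_space (wigner_entries n)"
  unfolding wigner_entries_def by (intro prob_space_PiM std_complex_normal.prob_space_axioms)

lemma prob_space_gauss_vectors: "prob_space (gauss_vectors n)"
  unfolding gauss_vectors_def by (intro prob_space_PiM std_complex_normal.prob_space_axioms)

lemma measurable_gauss_vectors_component: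
  assumes "f \<in> measurable M (gauss_vectors n)" "i < n"
  shows "(\<lambda>x. f x i) \<in> borel_measurable M"
  using measurable_compose[OF assms(1)[unfolded gauss_vectors_def] measurable_component_singleton[of i "{..<n}"]] assms(2)
  by (simp cong: measurable_cong_sets)

lemma measurable_wigner_entries_component:
  assumes "f \<in> measurable M (wigner_entries n)" "p \<in> index_pairs n"
  shows "(\<lambda>x. f x p) \<in> borel_measurable M"
  using measurable_compose[OF assms(1)[unfolded wigner_entries_eq] measurable_component_singleton[of p "index_pairs n"]] assms(2)
  by (simp cong: measurable_cong_sets)

text \<open>Measurability is asked coordinatewise so that the lemma also covers an arbitrary
  constant \<open>w\<close>, possibly outside the space of extensional functions, as in
  \<open>measurable_wigner_form_vector\<close>.\<close>

lemma measurable_wigner_form_components: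
  assumes f: "\<And>p. p \<in> index_pairs n \<Longrightarrow> (\<lambda>x. f x p) \<in> borel_measurable M"
    and h: "\<And>i. i < n \<Longrightarrow> (\<lambda>x. h x i) \<in> borel_measurable M"
  shows "(\<lambda>x. wigner_form n (f x) (h x)) \<in> borel_measurable M"
  unfolding wigner_form_def
proof (intro borel_measurable_sum borel_measurable_times borel_measurable_const)
  fix p assume p: "p \<in> index_pairs n"
  note b = index_pairs_bounds[OF p]
  have "(\<lambda>x. cnj (h x (fst p))) \<in> borel_measurable M"
    by (rule measurable_compose[OF h]) (use b in \<open>auto intro!: borel_measurable_continuous_onI continuous_intros\<close>)
  then have "(\<lambda>x. cnj (h x (fst p)) * f x p * h x (snd p)) \<in> borel_measurable M"
    using b p by (intro borel_measurable_times f h) auto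
  then show "(\<lambda>x. Re (cnj (h x (fst p)) * f x p * h x (snd p))) \<in> borel_measurable M"
    by (rule measurable_compose) (intro borel_measurable_continuous_onI continuous_intros)
qed

lemma measurable_wigner_form [measurable (raw)]:
  assumes "f \<in> measurable M (wigner_entries n)" "h \<in> measurable M (gauss_vectors n)"
  shows "(\<lambda>x. wigner_form n (f x) (h x)) \<in> borel_measurable M"
  using assms by (intro measurable_wigner_form_components measurable_wigner_entries_component
    measurable_gauss_vectors_component)

lemma measurable_wigner_form_vector: "wigner_form n w \<in> borel_measurable (gauss_vectors n)"
  using measurable_gauss_vectors_component[OF measurable_ident] by (intro measurable_wigner_form_components) auto

lemma measurable_pair_energy [measurable (raw)]:
  assumes [measurable]: "h \<in> measurable M (gauss_vectors n)"
  shows "(\<lambda>x. pair_energy n (h x)) \<in> borel_measurable M"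
  unfolding pair_energy_def
  by (intro borel_measurable_sum borel_measurable_times borel_measurable_power
      measurable_compose[OF _ borel_measurable_norm] measurable_gauss_vectors_component[OF assms])
     (auto dest: index_pairs_bounds)

lemma measurable_exp_average [measurable]:
  "exp_average n t \<in> borel_measurable (wigner_entries n)"
proof -
  interpret G: prob_space "gauss_vectors n" by (rule prob_space_gauss_vectors)
  show ?thesis unfolding exp_average_def by measurable
qed

text \<open>For each fixed \<open>g\<close> the form is linear in the independent entries, and the
  \<open>pair_energy\<close> term cancels its moment generating function exactly. So the average
  over \<open>w\<close> is already 1, and Fubini's theorem lets \<open>g\<close> be integrated
  last.\<close>

lemma exp_average_mean: "(\<integral>\<^sup>+w. exp_average n t w \<partial>wigner_entries n) = 1"
proof -
  interpret G: prob_space "gauss_vectors n" by (rule prob_space_gauss_vectors)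
  interpret W: prob_space "wigner_entries n" by (rule prob_space_wigner_entries)
  interpret GW: pair_sigma_finite "wigner_entries n" "gauss_vectors n" ..
  have inner: "(\<integral>\<^sup>+w. ennreal (exp (t * wigner_form n w g - t\<^sup>2 * pair_energy n g)) \<partial>wigner_entries n) = 1" for g
  proof -
    define c where "c p = complex_of_real t * (cnj (g (fst p)) * g (snd p))" for p
    have "ennreal (exp (t * wigner_form n w g - t\<^sup>2 * pair_energy n g))
       = ennreal (exp (- t\<^sup>2 * pair_energy n g)) * ennreal (exp (\<Sum>p\<in>index_pairs n. 2 * Re (c p * w p)))" for w
    proof -
      have "t * wigner_form n w g = (\<Sum>p\<in>index_pairs n. 2 * Re (c p * w p))"
        unfolding wigner_form_def sum_distrib_left
        by (intro sum.cong) (auto simp: c_def algebra_simps)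
      then show ?thesis
        by (simp only: ennreal_mult[symmetric] exp_ge_zero exp_add[symmetric]) simp
    qed
    then have "(\<integral>\<^sup>+w. ennreal (exp (t * wigner_form n w g - t\<^sup>2 * pair_energy n g)) \<partial>wigner_entries n)
      = ennreal (exp (- t\<^sup>2 * pair_energy n g)) * (\<integral>\<^sup>+w. ennreal (exp (\<Sum>p\<in>index_pairs n. 2 * Re (c p * w p))) \<partial>wigner_entries n)"
      by (simp only:) (rule nn_integral_cmult, simp only: wigner_entries_eq, measurable)
    also have "\<dots> = ennreal (exp (- t\<^sup>2 * pair_energy n g)) * ennreal (exp (\<Sum>p\<in>index_pairs n. (cmod (c p))\<^sup>2))"
      unfolding wigner_entries_eq by (subst PiM_std_complex_normal_mgf) auto
    also have "(\<Sum>p\<in>index_pairs n. (cmod (c p))\<^sup>2) = t\<^sup>2 * pair_energy n g"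
      unfolding pair_energy_def sum_distrib_left
      by (intro sum.cong) (auto simp: c_def norm_mult power_mult_distrib)
    finally show ?thesis
      by (simp add: ennreal_mult[symmetric] exp_add[symmetric])
  qed
  have "(\<integral>\<^sup>+w. exp_average n t w \<partial>wigner_entries n)
     = (\<integral>\<^sup>+g. (\<integral>\<^sup>+w. ennreal (exp (t * wigner_form n w g - t\<^sup>2 * pair_energy n g)) \<partial>wigner_entries n) \<partial>gauss_vectors n)"
    unfolding exp_average_def by (rule GW.Fubini'[symmetric]) measurable
  also have "\<dots> = 1"
    by (simp add: inner G.emeasure_space_1)
  finally show ?thesis .
qed

section \<open>Expectations after shifting and scaling a Gaussian vector\<close>

lemma has_bochner_integral_affine:
  "has_bochner_integral std_complex_normal (\<lambda>z. m + \<rho> *\<^sub>R z) m"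
  using integrable_std_complex_normal_id integral_std_complex_normal_id std_complex_normal.prob_space
  by (simp add: has_bochner_integral_iff)

lemma has_bochner_integral_norm_square_affine:
  "has_bochner_integral std_complex_normal (\<lambda>z. (cmod (m + \<rho> *\<^sub>R z))\<^sup>2) ((cmod m)\<^sup>2 + \<rho>\<^sup>2)"
proof -
  have eq: "(cmod (m + \<rho> *\<^sub>R z))\<^sup>2 = (cmod m)\<^sup>2 + (2 * \<rho> * Re (cnj m * z) + \<rho>\<^sup>2 * (cmod z)\<^sup>2)" for z
    unfolding cmod_power2 by (simp add: power2_eq_square algebra_simps)
  have "has_bochner_integral std_complex_normal (\<lambda>z. z) 0"
    using integrable_std_complex_normal_id integral_std_complex_normal_id by (simp add: has_bochner_integral_iff)
  then have "has_bochner_integral std_complex_normal (\<lambda>z. Re (cnj m * z)) (Re (cnj m * 0))"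
    by (intro has_bochner_integral_bounded_linear[OF bounded_linear_Re] has_bochner_integral_mult_right)
  from has_bochner_integral_mult_right[OF this, of "2 * \<rho>"]
  have 1: "has_bochner_integral std_complex_normal (\<lambda>z. 2 * \<rho> * Re (cnj m * z)) 0"
    by simp
  have 2: "has_bochner_integral std_complex_normal (\<lambda>z. \<rho>\<^sup>2 * (cmod z)\<^sup>2) (\<rho>\<^sup>2)"
    using has_bochner_integral_mult_right[OF has_bochner_integral_std_complex_normal_norm_square, of "\<rho>\<^sup>2"] by simp
  have 3: "has_bochner_integral std_complex_normal (\<lambda>z. (cmod m)\<^sup>2) ((cmod m)\<^sup>2)"
    using std_complex_normal.prob_space by (simp add: has_bochner_integral_iff)
  show ?thesis
    unfolding eq using has_bochner_integral_add[OF 3 has_bochner_integral_add[OF 1 2]] by simp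
qed


text \<open>Every term couples two different coordinates, since W has zero diagonal. The expectation
  of each product is the product of the means, and the centred Gaussian part contributes
  nothing.\<close>

lemma has_bochner_integral_wigner_form_shift:
  "has_bochner_integral (gauss_vectors n) (\<lambda>g. wigner_form n w (\<lambda>i. m i + \<rho> *\<^sub>R g i)) (wigner_form n w m)"
  unfolding wigner_form_def
proof (intro has_bochner_integral_sum has_bochner_integral_mult_right)
  fix p assume p: "p \<in> index_pairs n"
  note b = index_pairs_bounds[OF p]
  have "has_bochner_integral (gauss_vectors n) (\<lambda>g. (cnj (m (fst p) + \<rho> *\<^sub>R g (fst p)) * w p) * (m (snd p) + \<rho> *\<^sub>R g (snd p)))
     ((cnj (m (fst p)) * w p) * m (snd p))"
    unfolding gauss_vectors_def
    by (rule has_bochner_integral_PiM_mult_components[where f="\<lambda>z. cnj (m (fst p) + \<rho> *\<^sub>R z) * w p" and h="\<lambda>z. m (snd p) + \<rho> *\<^sub>R z"])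
      (use b in \<open>auto intro!: has_bochner_integral_mult_left has_bochner_integral_affine
         has_bochner_integral_bounded_linear[OF bounded_linear_cnj] simp del: complex_cnj_add\<close>)
  then show "has_bochner_integral (gauss_vectors n) (\<lambda>g. Re (cnj (m (fst p) + \<rho> *\<^sub>R g (fst p)) * w p * (m (snd p) + \<rho> *\<^sub>R g (snd p))))
     (Re (cnj (m (fst p)) * w p * m (snd p)))"
    by (rule has_bochner_integral_bounded_linear[OF bounded_linear_Re])
qed

lemma has_bochner_integral_pair_energy_shift:
  "has_bochner_integral (gauss_vectors n) (\<lambda>g. pair_energy n (\<lambda>i. m i + \<rho> *\<^sub>R g i))
     (\<Sum>p\<in>index_pairs n. ((cmod (m (fst p)))\<^sup>2 + \<rho>\<^sup>2) * ((cmod (m (snd p)))\<^sup>2 + \<rho>\<^sup>2))"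
  unfolding pair_energy_def gauss_vectors_def
proof (intro has_bochner_integral_sum)
  fix p assume p: "p \<in> index_pairs n"
  show "has_bochner_integral (PiM {..<n} (\<lambda>_. std_complex_normal))
     (\<lambda>g. (cmod (m (fst p) + \<rho> *\<^sub>R g (fst p)))\<^sup>2 * (cmod (m (snd p) + \<rho> *\<^sub>R g (snd p)))\<^sup>2)
     (((cmod (m (fst p)))\<^sup>2 + \<rho>\<^sup>2) * ((cmod (m (snd p)))\<^sup>2 + \<rho>\<^sup>2))"
    by (rule has_bochner_integral_PiM_mult_components[where f="\<lambda>z. (cmod (m (fst p) + \<rho> *\<^sub>R z))\<^sup>2"
         and h="\<lambda>z. (cmod (m (snd p) + \<rho> *\<^sub>R z))\<^sup>2"])
      (use index_pairs_bounds[OF p] in \<open>auto intro: has_bochner_integral_norm_square_affine\<close>)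
qed

text \<open>The square of the sum contains every pair twice, plus the diagonal terms
  \<open>b i * b i\<close>, which are nonnegative whatever the sign of \<open>b i\<close>.\<close>

lemma sum_index_pairs_mult_le:
  fixes b :: "nat \<Rightarrow> real"
  shows "2 * (\<Sum>p\<in>index_pairs n. b (fst p) * b (snd p)) \<le> (\<Sum>i<n. b i)\<^sup>2"
proof -
  have "(\<Sum>i<n. b i)\<^sup>2 = (\<Sum>i<n. \<Sum>j<n. b i * b j)"
    by (simp add: power2_eq_square sum_product)
  also have "\<dots> = (\<Sum>(i, j)\<in>index_pairs n. 2 * (b i * b j)) + (\<Sum>i<n. b i * b i)"
    by (subst sum_square_eq_index_pairs) (simp add: mult.commute)
  also have "(\<Sum>(i, j)\<in>index_pairs n. 2 * (b i * b j)) = 2 * (\<Sum>p\<in>index_pairs n. b (fst p) * b (snd p))"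
    by (simp add: case_prod_beta sum_distrib_left)
  finally show ?thesis
    by (simp add: sum_nonneg)
qed

text \<open>Recentre the Gaussian direction at \<open>m\<close> and apply Jensen's inequality to the
  logarithm \<open>H\<close> of the resulting integrand. Its mean contains the form at
  \<open>m\<close> itself; the costs are the Jacobian, log 2 per coordinate, and the pair
  energy.\<close>

lemma exp_average_lower_bound:
  assumes m: "(\<Sum>i<n. (cmod (m i))\<^sup>2) = real n / 2"
  shows "ennreal (exp (t * wigner_form n w m - t\<^sup>2 * (real n)\<^sup>2 / 2 - real n * ln 2)) \<le> exp_average n t w"
proof -
  interpret G: prob_space "gauss_vectors n" by (rule prob_space_gauss_vectors)
  \<comment> \<open>Variance 1/2 per coordinate together with squared norm n/2 of \<open>m\<close>
    keeps the expected squared norm of the shifted vector equal to n, so the density ratios have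
    total mean exponent 0.\<close>
  define \<rho> where "\<rho> = 1 / sqrt (2::real)"
  have \<rho>: "\<rho> \<noteq> 0" "\<rho>\<^sup>2 = 1/2"
    by (auto simp: \<rho>_def power_divide)
  define T where "T g = (\<lambda>i. m i + \<rho> *\<^sub>R g i)" for g :: "nat \<Rightarrow> complex"
  \<comment> \<open>Each \<open>- ln 2\<close> is the logarithm of the Jacobian factor
    \<open>\<rho>\<^sup>2\<close>.\<close>
  define H where "H g = (\<Sum>i<n. - ln 2 + ((cmod (g i))\<^sup>2 - (cmod (m i + \<rho> *\<^sub>R g i))\<^sup>2))
     + (t * wigner_form n w (T g) - t\<^sup>2 * pair_energy n (T g))" for g
  define b where "b i = (cmod (m i))\<^sup>2 + \<rho>\<^sup>2" for i
  have b: "(\<Sum>i<n. b i) = n"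
    using m by (simp add: b_def sum.distrib \<rho>(2))
  define E where "E = (\<Sum>i<n. - ln 2 + (1 - b i)) + (t * wigner_form n w m - t\<^sup>2 * (\<Sum>p\<in>index_pairs n. b (fst p) * b (snd p)))"
  have "has_bochner_integral (gauss_vectors n) H E"
    unfolding H_def E_def T_def
  proof (intro has_bochner_integral_add has_bochner_integral_diff has_bochner_integral_mult_right has_bochner_integral_sum)
    show "has_bochner_integral (gauss_vectors n) (\<lambda>g. - ln 2 :: real) (- ln 2)"
      using G.prob_space by (simp add: has_bochner_integral_iff)
    fix i assume i: "i \<in> {..<n}"
    show "has_bochner_integral (gauss_vectors n) (\<lambda>g. (cmod (g i))\<^sup>2) 1"
      using i has_bochner_integral_std_complex_normal_norm_square unfolding gauss_vectors_def
      by (intro has_bochner_integral_PiM_component) auto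
    show "has_bochner_integral (gauss_vectors n) (\<lambda>g. (cmod (m i + \<rho> *\<^sub>R g i))\<^sup>2) (b i)"
      unfolding gauss_vectors_def b_def using i
      by (intro has_bochner_integral_PiM_component[where f="\<lambda>z. (cmod (m i + \<rho> *\<^sub>R z))\<^sup>2"] has_bochner_integral_norm_square_affine) auto
  next
    show "has_bochner_integral (gauss_vectors n) (\<lambda>g. wigner_form n w (\<lambda>i. m i + \<rho> *\<^sub>R g i)) (wigner_form n w m)"
      by (rule has_bochner_integral_wigner_form_shift)
    show "has_bochner_integral (gauss_vectors n) (\<lambda>g. pair_energy n (\<lambda>i. m i + \<rho> *\<^sub>R g i))
       (\<Sum>p\<in>index_pairs n. b (fst p) * b (snd p))"
      unfolding b_def by (rule has_bochner_integral_pair_energy_shift)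
  qed
  then have "ennreal (exp E) \<le> (\<integral>\<^sup>+g. ennreal (exp (H g)) \<partial>gauss_vectors n)"
    by (rule G.exp_expectation_le_nn_integral)
  also have "(\<integral>\<^sup>+g. ennreal (exp (H g)) \<partial>gauss_vectors n) = exp_average n t w"
  proof -
    have e: "ennreal (exp (H g)) = (\<Prod>i<n. ennreal (\<rho>\<^sup>2 * exp ((cmod (g i))\<^sup>2 - (cmod (m i + \<rho> *\<^sub>R g i))\<^sup>2)))
       * ennreal (exp (t * wigner_form n w (\<lambda>i\<in>{..<n}. m i + \<rho> *\<^sub>R g i) - t\<^sup>2 * pair_energy n (\<lambda>i\<in>{..<n}. m i + \<rho> *\<^sub>R g i)))" for g
    proof -
      have 1: "wigner_form n w (\<lambda>i\<in>{..<n}. m i + \<rho> *\<^sub>R g i) = wigner_form n w (T g)"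
        by (rule wigner_form_cong) (simp add: T_def)
      have 2: "pair_energy n (\<lambda>i\<in>{..<n}. m i + \<rho> *\<^sub>R g i) = pair_energy n (T g)"
        by (rule pair_energy_cong) (simp add: T_def)
      have 3: "exp (- ln 2 + x) = \<rho>\<^sup>2 * exp x" for x :: real
        by (simp add: \<rho> exp_diff)
      show ?thesis
        unfolding H_def 1 2 exp_add[of "sum _ _"] exp_sum[OF finite_lessThan] 3
        by (subst ennreal_mult) (auto simp only: prod_ennreal mult_nonneg_nonneg zero_le_power2 exp_ge_zero
            intro!: prod_nonneg)
    qed
    show ?thesis
      unfolding e exp_average_def gauss_vectors_def
      by (rule nn_integral_PiM_std_complex_normal_affine[symmetric, OF _ \<rho>(1), where
          f="\<lambda>g. ennreal (exp (t * wigner_form n w g - t\<^sup>2 * pair_energy n g))"])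
        (use measurable_wigner_form_vector[of n w, measurable] in \<open>auto simp: gauss_vectors_def[symmetric]\<close>)
  qed
  finally have *: "ennreal (exp E) \<le> exp_average n t w" .
  \<comment> \<open>Since the \<open>b i\<close> sum to n, the expected pair energy is at most n^2 /
    2.\<close>
  have "t\<^sup>2 * (2 * (\<Sum>p\<in>index_pairs n. b (fst p) * b (snd p))) \<le> t\<^sup>2 * (real n)\<^sup>2"
    using sum_index_pairs_mult_le[of b n] b by (intro mult_left_mono) auto
  then have "t * wigner_form n w m - t\<^sup>2 * (real n)\<^sup>2 / 2 - real n * ln 2 \<le> E"
    using b by (simp add: E_def sum.distrib sum_subtractf)
  then show ?thesis
    using order_trans[OF _ *] by (auto intro: ennreal_leI)
qed

section \<open>Concentration of the noise\<close>

definition wigner_row :: "nat \<Rightarrow> (nat \<times> nat \<Rightarrow> complex) \<Rightarrow> (nat \<Rightarrow> complex) \<Rightarrow> nat \<Rightarrow> complex" where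
  "wigner_row n w z i = (\<Sum>j<n. wigner_matrix w i j * z j)"

text \<open>Only pairs containing \<open>i\<close> contribute. An entry below the diagonal is the
  conjugate of an independent one; under the real part the conjugation moves to the
  coefficient.\<close>

lemma Re_wigner_row_eq:
  assumes "i < n"
  shows "Re (\<alpha> * wigner_row n w z i) = (\<Sum>p\<in>index_pairs n. Re ((if fst p = i then \<alpha> * z (snd p)
      else if snd p = i then cnj (\<alpha> * z (fst p)) else 0) * w p))"
proof -
  define f where "f a b = (if a = i then Re (\<alpha> * (wigner_matrix w a b * z b)) else 0)" for a b
  have "Re (\<alpha> * wigner_row n w z i) = (\<Sum>a<n. \<Sum>b<n. f a b)"
  proof -
    have "(\<Sum>a<n. \<Sum>b<n. f a b) = (\<Sum>a<n. if a = i then (\<Sum>b<n. Re (\<alpha> * (wigner_matrix w i b * z b))) else 0)"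
      by (intro sum.cong) (auto simp: f_def)
    then show ?thesis
      using assms by (simp add: wigner_row_def sum_distrib_left del: times_complex.sel)
  qed
  also have "\<dots> = (\<Sum>(a, b)\<in>index_pairs n. f a b + f b a)"
    by (subst sum_square_eq_index_pairs) (simp add: f_def wigner_matrix_def)
  also have "\<dots> = (\<Sum>p\<in>index_pairs n. Re ((if fst p = i then \<alpha> * z (snd p)
      else if snd p = i then cnj (\<alpha> * z (fst p)) else 0) * w p))"
  proof (intro sum.cong refl, unfold case_prod_beta)
    fix p assume "p \<in> index_pairs n"
    then have lt: "fst p < snd p" by (rule index_pairs_bounds[THEN conjunct1])
    then have W: "wigner_matrix w (fst p) (snd p) = w p" "wigner_matrix w (snd p) (fst p) = cnj (w p)"
      by (simp_all add: wigner_matrix_def)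
    have "Re (\<alpha> * (cnj (w p) * z (fst p))) = Re (cnj (\<alpha> * z (fst p)) * w p)"
      by (simp add: algebra_simps)
    moreover have "Re (\<alpha> * (w p * z (snd p))) = Re (\<alpha> * z (snd p) * w p)"
      by (simp only: mult_ac)
    ultimately show "f (fst p) (snd p) + f (snd p) (fst p) = Re ((if fst p = i then \<alpha> * z (snd p)
      else if snd p = i then cnj (\<alpha> * z (fst p)) else 0) * w p)"
      using lt unfolding f_def W
      by (cases "fst p = i"; cases "snd p = i") (simp_all del: times_complex.sel complex_cnj_mult)
  qed
  finally show ?thesis .
qed

text \<open>Coefficients of modulus 1 occur exactly at the pairs containing \<open>i\<close>; adding
  the diagonal position completes a row of n ones.\<close>

lemma wigner_row_coefficients_norm:
  assumes "i < n" "cmod \<alpha> = 1" "unimod n z"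
  shows "(\<Sum>p\<in>index_pairs n. (cmod (if fst p = i then \<alpha> * z (snd p)
      else if snd p = i then cnj (\<alpha> * z (fst p)) else 0))\<^sup>2) \<le> real n"
proof -
  define f where "f a b = (if a = i then 1 else 0 :: real)" for a b :: nat
  have "(\<Sum>p\<in>index_pairs n. (cmod (if fst p = i then \<alpha> * z (snd p)
      else if snd p = i then cnj (\<alpha> * z (fst p)) else 0))\<^sup>2) = (\<Sum>(a, b)\<in>index_pairs n. f a b + f b a)"
    using assms by (intro sum.cong) (auto simp: f_def index_pairs_def unimod_def norm_mult)
  also have "\<dots> \<le> (\<Sum>a<n. \<Sum>b<n. f a b)"
    by (subst sum_square_eq_index_pairs) (simp add: f_def sum_nonneg)
  also have "\<dots> = (\<Sum>a<n. if a = i then real n else 0)"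
    by (intro sum.cong) (auto simp: f_def)
  also have "\<dots> = n"
    using assms by simp
  finally show ?thesis .
qed

lemma measurable_wigner_row: "i < n \<Longrightarrow> (\<lambda>w. Re (\<alpha> * wigner_row n w z i)) \<in> borel_measurable (wigner_entries n)"
proof -
  assume i: "i < n"
  have "(\<lambda>w. c * w p) \<in> borel_measurable (wigner_entries n)" if "p \<in> index_pairs n" for c p
    using measurable_wigner_entries_component[OF measurable_ident that] by auto
  then have "(\<lambda>w. Re (c * w p)) \<in> borel_measurable (wigner_entries n)" if "p \<in> index_pairs n" for c p
    by (rule measurable_compose) (intro that borel_measurable_continuous_onI continuous_intros)+
  then show ?thesis
    unfolding Re_wigner_row_eq[OF i] by (intro borel_measurable_sum)
qed

lemma wigner_row_tail:
  assumes i: "i < n" and \<alpha>: "cmod \<alpha> = 1" and z: "unimod n z" and \<tau>: "\<tau> \<ge> 0"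
  shows "measure (wigner_entries n) {w\<in>space (wigner_entries n). \<tau> \<le> Re (\<alpha> * wigner_row n w z i)}
    \<le> exp (- \<tau>\<^sup>2 / n)"
proof -
  interpret W: prob_space "wigner_entries n" by (rule prob_space_wigner_entries)
  \<comment> \<open>The minimiser of the Chernoff exponent
    \<open>- 2 * s * \<tau> + s\<^sup>2 * n\<close>, with minimum
    \<open>- \<tau>\<^sup>2 / n\<close>.\<close>
  define s where "s = \<tau> / n"
  define c where "c p = (if fst p = i then \<alpha> * z (snd p) else if snd p = i then cnj (\<alpha> * z (fst p)) else 0)" for p
  let ?Y = "\<lambda>w. Re (\<alpha> * wigner_row n w z i)"
  note [measurable] = measurable_wigner_row[OF i, of \<alpha> z]
  have e: "2 * s * ?Y w = (\<Sum>p\<in>index_pairs n. 2 * Re ((of_real s * c p) * w p))" for w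
    unfolding Re_wigner_row_eq[OF i] c_def[symmetric] sum_distrib_left
    by (intro sum.cong) (auto simp: algebra_simps)
  have "emeasure (wigner_entries n) {w\<in>space (wigner_entries n). \<tau> \<le> ?Y w}
     \<le> emeasure (wigner_entries n) ({w\<in>space (wigner_entries n). 1 \<le> ennreal (exp (- 2 * s * \<tau>)) * ennreal (exp (2 * s * ?Y w))})"
  proof (rule emeasure_mono)
    have "1 \<le> ennreal (exp (- 2 * s * \<tau>)) * ennreal (exp (2 * s * y))" if "\<tau> \<le> y" for y
    proof -
      have "s * \<tau> \<le> s * y"
        using that \<tau> by (intro mult_left_mono) (auto simp: s_def)
      then have "1 \<le> exp (- 2 * s * \<tau> + 2 * s * y)"
        by simp
      then show ?thesis
        unfolding exp_add by (simp add: ennreal_mult[symmetric] ennreal_ge_1)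
    qed
    then show "{w\<in>space (wigner_entries n). \<tau> \<le> ?Y w} \<subseteq> {w\<in>space (wigner_entries n). 1 \<le> ennreal (exp (- 2 * s * \<tau>)) * ennreal (exp (2 * s * ?Y w))}"
      by blast
  qed measurable
  also have "\<dots> \<le> ennreal (exp (- 2 * s * \<tau>)) * (\<integral>\<^sup>+w. ennreal (exp (2 * s * ?Y w)) * indicator (space (wigner_entries n)) w \<partial>wigner_entries n)"
    by (rule order_trans[OF _ nn_integral_Markov_inequality]) (auto intro!: emeasure_mono simp del: times_complex.sel)
  also have "(\<integral>\<^sup>+w. ennreal (exp (2 * s * ?Y w)) * indicator (space (wigner_entries n)) w \<partial>wigner_entries n)
     = (\<integral>\<^sup>+w. ennreal (exp (\<Sum>p\<in>index_pairs n. 2 * Re ((of_real s * c p) * w p))) \<partial>wigner_entries n)"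
    unfolding e by (intro nn_integral_cong) simp
  also have "\<dots> = ennreal (exp (\<Sum>p\<in>index_pairs n. (cmod (of_real s * c p))\<^sup>2))"
    unfolding wigner_entries_eq by (rule PiM_std_complex_normal_mgf) simp
  also have "(\<Sum>p\<in>index_pairs n. (cmod (of_real s * c p))\<^sup>2) = s\<^sup>2 * (\<Sum>p\<in>index_pairs n. (cmod (c p))\<^sup>2)"
    by (simp add: norm_mult power_mult_distrib sum_distrib_left)
  also have "ennreal (exp (- 2 * s * \<tau>)) * ennreal (exp (s\<^sup>2 * (\<Sum>p\<in>index_pairs n. (cmod (c p))\<^sup>2)))
     \<le> ennreal (exp (- 2 * s * \<tau> + s\<^sup>2 * n))"
    using mult_left_mono[OF wigner_row_coefficients_norm[OF i \<alpha> z], of "s\<^sup>2"]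
    by (subst ennreal_mult[symmetric]) (auto simp: exp_add[symmetric] c_def intro!: ennreal_leI)
  also have "- 2 * s * \<tau> + s\<^sup>2 * n = - \<tau>\<^sup>2 / n"
    using i by (simp add: s_def power2_eq_square field_simps)
  finally show ?thesis
    by (simp add: W.emeasure_eq_measure)
qed

section \<open>Uniform bound on the quadratic form\<close>

lemma wigner_form_scale: "wigner_form n w (\<lambda>i. complex_of_real r * v i) = r\<^sup>2 * wigner_form n w v"
proof -
  have "cnj (complex_of_real r * a) * y * (complex_of_real r * b) = complex_of_real (r\<^sup>2) * (cnj a * y * b)" for a b y
    by (simp add: power2_eq_square)
  then have *: "Re (cnj (complex_of_real r * a) * y * (complex_of_real r * b)) = r\<^sup>2 * Re (cnj a * y * b)" for a b y
    by (simp only: Re_complex_of_real Im_complex_of_real times_complex.sel(1)[of "complex_of_real _"])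
  show ?thesis
    unfolding wigner_form_def sum_distrib_left * by (simp only: mult_ac)
qed

text \<open>The assumption on \<open>w\<close> does not mention \<open>v\<close>, so a single
  exceptional event serves all directions at once, without a net. By homogeneity \<open>v\<close>
  may be rescaled to the norm that \<open>exp_average_lower_bound\<close> asks for.\<close>

lemma scaled_wigner_form_le:
  assumes n: "n > 0" and e: "\<epsilon>\<^sup>2 = 1"
    and lt: "exp_average n (2 * \<epsilon> / sqrt n) w < ennreal (exp n)"
  shows "\<epsilon> * wigner_form n w v \<le> 4 * sqrt n * (\<Sum>i<n. (cmod (v i))\<^sup>2)"
proof (cases "(\<Sum>i<n. (cmod (v i))\<^sup>2) = 0")
  case True
  then have "v i = 0" if "i < n" for i
    using that by (subst (asm) sum_nonneg_eq_0_iff) auto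
  then have "wigner_form n w v = wigner_form n w (\<lambda>_. 0)"
    by (intro wigner_form_cong) auto
  then show ?thesis using True by (simp add: wigner_form_def)
next
  case False
  define s where "s = (\<Sum>i<n. (cmod (v i))\<^sup>2)"
  have s: "s > 0"
    using False by (simp add: s_def order_less_le sum_nonneg)
  define r where "r = sqrt (n / (2 * s))"
  have r: "r\<^sup>2 = n / (2 * s)"
    using s by (simp add: r_def)
  have sq: "sqrt n * sqrt n = real n" "sqrt n > 0"
    using n by auto
  define m where "m = (\<lambda>i. complex_of_real r * v i)"
  have "(\<Sum>i<n. (cmod (m i))\<^sup>2) = r\<^sup>2 * s"
    by (simp add: m_def s_def norm_mult power_mult_distrib sum_distrib_left)
  then have "(\<Sum>i<n. (cmod (m i))\<^sup>2) = real n / 2"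
    using s by (simp add: r)
  from exp_average_lower_bound[OF this, of "2 * \<epsilon> / sqrt n" w] lt
  have "ennreal (exp (2 * \<epsilon> / sqrt n * wigner_form n w m - (2 * \<epsilon> / sqrt n)\<^sup>2 * (real n)\<^sup>2 / 2 - real n * ln 2)) < ennreal (exp n)"
    by (rule order.strict_trans1)
  then have "2 * \<epsilon> / sqrt n * wigner_form n w m - (2 * \<epsilon> / sqrt n)\<^sup>2 * (real n)\<^sup>2 / 2 - real n * ln 2 < real n"
    by (subst (asm) ennreal_less_iff) auto
  \<comment> \<open>The total 4n is the sum of n from the threshold \<open>exp n\<close>, 2n from
    the pair energy and at most n from the Jacobian.\<close>
  moreover have "(2 * \<epsilon> / sqrt n)\<^sup>2 * (real n)\<^sup>2 / 2 = 2 * real n"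
    using n e by (simp add: power_divide power_mult_distrib power2_eq_square)
  moreover have "real n * ln 2 \<le> real n * 1"
    using ln_2_less_1 by (intro mult_left_mono) auto
  ultimately have "2 * \<epsilon> / sqrt n * wigner_form n w m < 4 * real n"
    by simp
  moreover have "2 * \<epsilon> / sqrt n * wigner_form n w m = sqrt n * (\<epsilon> * wigner_form n w v) / s"
    unfolding m_def wigner_form_scale r using s sq n by (simp add: field_simps)
  ultimately have "sqrt n * (\<epsilon> * wigner_form n w v) / s < 4 * real n"
    by simp
  then have "sqrt n * (\<epsilon> * wigner_form n w v) < 4 * real n * s"
    using s by (simp only: pos_divide_less_eq)
  then have "sqrt n * (\<epsilon> * wigner_form n w v) < sqrt n * (4 * sqrt n * s)"
    using arg_cong[OF sq(1), of "\<lambda>y. 4 * y * s"] by (simp only: mult_ac)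
  then show ?thesis
    using sq(2) by (simp add: s_def)
qed

lemma norm_le_sqrt2_of_Re:
  assumes "Re y < \<tau>" "Re (- y) < \<tau>" "Re (\<i> * y) < \<tau>" "Re (- \<i> * y) < \<tau>"
  shows "cmod y \<le> sqrt 2 * \<tau>"
proof -
  have "\<bar>Re y\<bar> \<le> \<tau>" "\<bar>Im y\<bar> \<le> \<tau>" using assms by auto
  then have "(Re y)\<^sup>2 \<le> \<tau>\<^sup>2" "(Im y)\<^sup>2 \<le> \<tau>\<^sup>2"
    by (metis abs_le_square_iff abs_of_nonneg abs_ge_zero order_trans)+
  then have "(cmod y)\<^sup>2 \<le> (sqrt 2 * \<tau>)\<^sup>2"
    by (simp add: cmod_power2 power_mult_distrib)
  moreover have "0 \<le> \<tau>" using \<open>\<bar>Re y\<bar> \<le> \<tau>\<close> by linarith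
  ultimately show ?thesis
    by (intro power2_le_imp_le[of "cmod y"]) simp_all
qed

text \<open>Union bound. By Markov's inequality and \<open>exp_average_mean\<close> the events
  \<open>B 1\<close> and \<open>B (-1)\<close> have probability at most exp (-n) each, together at
  most 4 n^(-2). At most 4n Chernoff events of probability n^(-3) add 4 n^(-2). The exponent -2 is
  then weakened to -5/4.\<close>

lemma wigner_good_event:
  assumes n: "n \<ge> 2" and z: "unimod n z"
  shows "\<exists>A\<in>sets (wigner_entries n). measure (wigner_entries n) A \<ge> 1 - 8 * real n powr (-5/4) \<and>
    (\<forall>w\<in>A. (\<forall>v. \<bar>wigner_form n w v\<bar> \<le> 4 * sqrt n * (\<Sum>i<n. (cmod (v i))\<^sup>2)) \<and>
      (\<forall>i<n. cmod (wigner_row n w z i) \<le> 5/2 * sqrt (real n * ln n)))"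
proof -
  interpret W: prob_space "wigner_entries n" by (rule prob_space_wigner_entries)
  \<comment> \<open>Chosen so that the tail \<open>exp (- \<tau>\<^sup>2 / n)\<close> equals
    n^(-3).\<close>
  define \<tau> where "\<tau> = sqrt (3 * real n * ln n)"
  define B where "B \<epsilon> = {w\<in>space (wigner_entries n). ennreal (exp n) \<le> exp_average n (2 * \<epsilon> / sqrt n) w}" for \<epsilon>
  define R where "R = (\<lambda>(i, \<alpha>). {w\<in>space (wigner_entries n). \<tau> \<le> Re (\<alpha> * wigner_row n w z i)})"
  define I where "I = {..<n} \<times> {1, -1, \<i>, - \<i>}"
  have B[measurable]: "B \<epsilon> \<in> sets (wigner_entries n)" for \<epsilon>
    unfolding B_def by (rule borel_measurable_le[OF borel_measurable_const measurable_exp_average])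
  have R: "R p \<in> sets (wigner_entries n)" if p_in: "p \<in> I" for p
  proof -
    obtain i \<alpha> where p: "p = (i, \<alpha>)" "i < n" using p_in unfolding I_def by blast
    show ?thesis unfolding R_def p prod.case
      by (rule borel_measurable_le[OF borel_measurable_const measurable_wigner_row[OF p(2)]])
  qed
  have fin: "finite I" by (simp add: I_def)
  have ln: "ln (real n) \<ge> 0" using n by simp
  have mB: "measure (wigner_entries n) (B \<epsilon>) \<le> exp (- real n)" for \<epsilon>
  proof -
    have "emeasure (wigner_entries n) (B \<epsilon>) \<le> emeasure (wigner_entries n) {w\<in>space (wigner_entries n). 1 \<le> ennreal (exp (- real n)) * exp_average n (2 * \<epsilon> / sqrt n) w}"
    proof (rule emeasure_mono)
      have "1 \<le> ennreal (exp (- real n)) * y" if "ennreal (exp n) \<le> y" for y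
      proof -
        have "ennreal (exp (- real n)) * ennreal (exp n) \<le> ennreal (exp (- real n)) * y"
          using that by (intro mult_left_mono) auto
        then show ?thesis by (simp add: ennreal_mult[symmetric] exp_minus)
      qed
      then show "B \<epsilon> \<subseteq> {w\<in>space (wigner_entries n). 1 \<le> ennreal (exp (- real n)) * exp_average n (2 * \<epsilon> / sqrt n) w}"
        unfolding B_def by blast
    qed measurable
    also have "\<dots> \<le> ennreal (exp (- real n)) * (\<integral>\<^sup>+w. exp_average n (2 * \<epsilon> / sqrt n) w * indicator (space (wigner_entries n)) w \<partial>wigner_entries n)"
      by (rule order_trans[OF _ nn_integral_Markov_inequality]) (auto intro!: emeasure_mono)
    also have "(\<integral>\<^sup>+w. exp_average n (2 * \<epsilon> / sqrt n) w * indicator (space (wigner_entries n)) w \<partial>wigner_entries n)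
      = (\<integral>\<^sup>+w. exp_average n (2 * \<epsilon> / sqrt n) w \<partial>wigner_entries n)"
      by (intro nn_integral_cong) simp
    finally show ?thesis
      by (simp add: exp_average_mean W.emeasure_eq_measure)
  qed
  have mR: "measure (wigner_entries n) (R p) \<le> real n powr (-3)" if p_in: "p \<in> I" for p
  proof -
    obtain i \<alpha> where p: "p = (i, \<alpha>)" "i < n" "\<alpha> \<in> {1, -1, \<i>, - \<i>}" using p_in unfolding I_def by blast
    then have \<alpha>: "cmod \<alpha> = 1" by auto
    have "measure (wigner_entries n) (R p) \<le> exp (- \<tau>\<^sup>2 / n)"
      unfolding R_def p using wigner_row_tail[OF p(2) \<alpha> z, of \<tau>] ln by (simp add: \<tau>_def)
    also have "- \<tau>\<^sup>2 / n = -3 * ln n"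
      using n ln by (simp add: \<tau>_def)
    finally show ?thesis using n by (simp add: powr_def)
  qed
  define bad where "bad = B 1 \<union> B (-1) \<union> (\<Union>p\<in>I. R p)"
  have bad: "bad \<in> sets (wigner_entries n)"
    unfolding bad_def using R fin by (intro sets.Un B sets.finite_UN) auto
  have "measure (wigner_entries n) (\<Union>p\<in>I. R p) \<le> (\<Sum>p\<in>I. measure (wigner_entries n) (R p))"
    using R fin by (intro measure_UNION_le) auto
  also have "\<dots> \<le> (\<Sum>p\<in>I. real n powr (-3))"
    by (intro sum_mono mR)
  also have "\<dots> \<le> 4 * (real n * real n powr (-3))"
  proof -
    have "card I \<le> n * 4"
      unfolding I_def card_cartesian_product by (simp add: card_insert_if)
    then have "real (card I) \<le> 4 * real n" by linarith
    then have "real (card I) * real n powr (-3) \<le> 4 * real n * real n powr (-3)"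
      by (intro mult_right_mono) auto
    then show ?thesis by simp
  qed
  also have "real n * real n powr (-3) = real n powr (-2)"
    using n powr_add[of "real n" 1 "-3"] by simp
  finally have mRU: "measure (wigner_entries n) (\<Union>p\<in>I. R p) \<le> 4 * real n powr (-2)" .
  have e: "exp (- real n) \<le> 2 * real n powr (-2)"
  proof -
    have "(real n)\<^sup>2 / 2 \<le> exp n"
      using exp_lower_Taylor_quadratic[of "real n"] by simp
    then have *: "inverse (exp (real n)) \<le> inverse ((real n)\<^sup>2 / 2)"
      using n by (intro le_imp_inverse_le) auto
    note *
    also have "inverse ((real n)\<^sup>2 / 2) = 2 * inverse ((real n)\<^sup>2)"
      by (simp only: inverse_mult_distrib inverse_inverse_eq divide_inverse mult.commute)
    also have "inverse ((real n)\<^sup>2) = real n powr (-2)"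
      using powr_minus[of "real n" 2] powr_numeral[of "real n" "num.Bit0 num.One"] by (metis of_nat_0_le_iff)
    finally show ?thesis
      by (simp only: exp_minus)
  qed
  have "measure (wigner_entries n) bad \<le> measure (wigner_entries n) (B 1) + measure (wigner_entries n) (B (-1))
      + measure (wigner_entries n) (\<Union>p\<in>I. R p)"
    unfolding bad_def using R fin
    by (intro order_trans[OF measure_Un_le] add_mono order_refl sets.Un B sets.finite_UN) auto
  also have "\<dots> \<le> 8 * real n powr (-2)"
    using mB[of 1] mB[of "-1"] mRU e by linarith
  also have "\<dots> \<le> 8 * real n powr (-5/4)"
    using n by (intro mult_left_mono powr_mono) auto
  finally have "measure (wigner_entries n) (space (wigner_entries n) - bad) \<ge> 1 - 8 * real n powr (-5/4)"
    using bad by (subst W.prob_compl) auto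
  moreover have "\<bar>wigner_form n w v\<bar> \<le> 4 * sqrt n * (\<Sum>i<n. (cmod (v i))\<^sup>2)"
    if "w \<in> space (wigner_entries n) - bad" for w v
  proof -
    have "exp_average n (2 * \<epsilon> / sqrt n) w < ennreal (exp n)" if "\<epsilon> = 1 \<or> \<epsilon> = -1" for \<epsilon>
      using \<open>w \<in> space (wigner_entries n) - bad\<close> that by (auto simp: bad_def B_def not_le)
    from this[THEN scaled_wigner_form_le[rotated 2], of 1 v] this[THEN scaled_wigner_form_le[rotated 2], of "-1" v]
    show ?thesis using n by auto
  qed
  moreover have "cmod (wigner_row n w z i) \<le> 5/2 * sqrt (real n * ln n)"
    if "w \<in> space (wigner_entries n) - bad" "i < n" for w i
  proof -
    have "Re (\<alpha> * wigner_row n w z i) < \<tau>" if "\<alpha> \<in> {1, -1, \<i>, - \<i>}" for \<alpha>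
    proof -
      have "w \<notin> R (i, \<alpha>)"
        using \<open>i < n\<close> \<open>w \<in> space (wigner_entries n) - bad\<close> that unfolding bad_def I_def by blast
      then show ?thesis
        using \<open>w \<in> space (wigner_entries n) - bad\<close> by (auto simp: R_def not_le)
    qed
    from this[of 1] this[of "-1"] this[of \<i>] this[of "- \<i>"]
    have "cmod (wigner_row n w z i) \<le> sqrt 2 * \<tau>"
      by (intro norm_le_sqrt2_of_Re) auto
    also have "sqrt 2 * \<tau> = sqrt 6 * sqrt (real n * ln n)"
      by (simp add: \<tau>_def real_sqrt_mult[symmetric])
    \<comment> \<open>Here 6 <= 25/4.\<close>
    also have "\<dots> \<le> 5/2 * sqrt (real n * ln n)"
      using ln by (intro mult_right_mono real_le_lsqrt) (auto simp: power2_eq_square)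
    finally show ?thesis .
  qed
  ultimately show ?thesis
    using bad by (intro bexI[of _ "space (wigner_entries n) - bad"]) auto
qed

section \<open>Rank-one decomposition of positive semidefinite matrices\<close>

lemma qform_Suc:
  "qform (Suc n) Y v = qform n Y v + (\<Sum>i<n. cnj (v i) * Y i n) * v n
     + cnj (v n) * (\<Sum>j<n. Y n j * v j) + cnj (v n) * Y n n * v n"
  by (simp add: qform_def sum.distrib sum_distrib_left sum_distrib_right algebra_simps)

lemma qform_cong: "(\<And>i j. i < n \<Longrightarrow> j < n \<Longrightarrow> A i j = B i j) \<Longrightarrow> (\<And>i. i < n \<Longrightarrow> u i = v i) \<Longrightarrow> qform n A u = qform n B v"
  unfolding qform_def by (intro sum.cong) auto

lemma sum_mult_indicator:
  fixes f :: "nat \<Rightarrow> complex"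
  assumes "j < n"
  shows "(\<Sum>i<n. f i * (if i = j then a else 0)) = f j * a"
    "(\<Sum>i<n. (if i = j then a else 0) * f i) = a * f j"
proof -
  have 1: "f i * (if i = j then a else 0) = (if i = j then f i * a else 0)"
    "(if i = j then a else 0) * f i = (if i = j then a * f i else 0)" for i by auto
  show "(\<Sum>i<n. f i * (if i = j then a else 0)) = f j * a"
    "(\<Sum>i<n. (if i = j then a else 0) * f i) = a * f j"
  using assms by (simp_all add: 1)
qed

text \<open>Test with the j-th unit vector minus t times \<open>Y n j\<close> in coordinate
  \<open>n\<close>. As \<open>Y n n\<close> vanishes, the form is affine in t with slope -2 |Y n
  j|^2, and it would become negative for large t.\<close>

lemma psd_mat_last_row_zero:
  assumes Y: "psd_mat (Suc n) Y" and d: "Y n n = 0" and j: "j < n"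
  shows "Y n j = 0"
proof (rule ccontr)
  assume nz: "Y n j \<noteq> 0"
  have H: "Y j n = cnj (Y n j)" using Y j unfolding psd_mat_def hermitian_mat_def by (meson lessI less_SucI)
  have le: "2 * t * (cmod (Y n j))\<^sup>2 \<le> Re (Y j j)" for t
  proof -
    define e where "e = (\<lambda>i. if i = j then 1 else 0 :: complex)"
    define v where "v = e(n := - complex_of_real t * Y n j)"
    have v: "v i = e i" if "i < n" for i using that by (simp add: v_def)
    have vn: "v n = - complex_of_real t * Y n j" by (simp add: v_def)
    have q: "qform n Y v = Y j j"
    proof -
      have "qform n Y v = qform n Y e" by (rule qform_cong) (auto simp: v)
      also have "\<dots> = (\<Sum>i<n. (if i = j then 1 else 0) * (\<Sum>k<n. Y i k * (if k = j then 1 else 0)))"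
        unfolding qform_def e_def sum_distrib_left by (intro sum.cong refl) (auto)
      also have "\<dots> = Y j j"
        using j by (simp only: sum_mult_indicator) simp
      finally show ?thesis .
    qed
    have s1: "(\<Sum>i<n. cnj (v i) * Y i n) = Y j n"
    proof -
      have "(\<Sum>i<n. cnj (v i) * Y i n) = (\<Sum>i<n. (if i = j then 1 else 0) * Y i n)"
        by (intro sum.cong) (auto simp: v e_def)
      then show ?thesis using j by (simp only: sum_mult_indicator) simp
    qed
    have s2: "(\<Sum>i<n. Y n i * v i) = Y n j"
    proof -
      have "(\<Sum>i<n. Y n i * v i) = (\<Sum>i<n. Y n i * (if i = j then 1 else 0))"
        by (intro sum.cong) (auto simp: v e_def)
      then show ?thesis using j by (simp only: sum_mult_indicator) simp
    qed
    have "0 \<le> Re (qform (Suc n) Y v)" using Y by (simp add: psd_mat_def)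
    also have "qform (Suc n) Y v = Y j j - complex_of_real (2 * t * (cmod (Y n j))\<^sup>2)"
      unfolding qform_Suc q s1 s2 vn H d
      unfolding cmod_power2 by (simp add: complex_eq_iff power2_eq_square algebra_simps)
    finally show ?thesis by simp
  qed
  define c where "c = (cmod (Y n j))\<^sup>2"
  have "c > 0" using nz by (simp add: c_def)
  \<comment> \<open>This t makes the left side of \<open>le\<close> equal to
    \<open>Re (Y j j) + 1\<close>.\<close>
  then show False
    using le[of "(Re (Y j j) + 1) / (2 * c)"] unfolding c_def[symmetric] by (simp add: field_simps)
qed

text \<open>Induction by Schur complements, as in the Cholesky factorization: the last column
  divided by the root of the corner entry gives one rank-one term, and the complement
  \<open>Y'\<close> is again positive semidefinite.\<close>

lemma psd_mat_decomposition:
  "psd_mat n Y \<Longrightarrow> \<exists>V::nat \<Rightarrow> nat \<Rightarrow> complex. \<forall>i<n. \<forall>j<n. Y i j = (\<Sum>k<n. V i k * cnj (V j k))"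
proof (induction n arbitrary: Y)
  case 0
  then show ?case by simp
next
  case (Suc n)
  have H: "Y j i = cnj (Y i j)" if "i \<le> n" "j \<le> n" for i j
    using Suc.prems that unfolding psd_mat_def hermitian_mat_def by (meson less_Suc_eq_le)
  define d where "d = Re (Y n n)"
  have Ynn: "Y n n = complex_of_real d"
    using H[of n n] by (simp add: d_def complex_eq_iff)
  have d0: "d \<ge> 0"
  proof -
    define e where "e = (\<lambda>i. if i = n then 1 else 0 :: complex)"
    have "qform n Y e = 0" by (simp add: qform_def e_def)
    then have "qform (Suc n) Y e = Y n n"
      unfolding qform_Suc by (simp add: e_def)
    moreover have "0 \<le> Re (qform (Suc n) Y e)" using Suc.prems by (simp add: psd_mat_def)
    ultimately show ?thesis by (simp add: d_def)
  qed
  \<comment> \<open>For \<^term>\<open>d = 0\<close> the correction term vanishes because division by zero yields zero.\<close>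
  define Y' where "Y' i j = Y i j - Y i n * Y n j / d" for i j
  \<comment> \<open>For d > 0 the inserted last entry minimises the form of \<open>Y\<close> over
    all extensions of \<open>v\<close>, and the minimum is the form of the Schur complement.\<close>
  have q: "qform n Y' v = qform (Suc n) Y (v(n := - (\<Sum>j<n. Y n j * v j) / d))" for v
  proof -
    define b where "b = (\<Sum>j<n. Y n j * v j)"
    have cb: "(\<Sum>i<n. cnj (v i) * Y i n) = cnj b"
      unfolding b_def cnj_sum by (intro sum.cong) (simp_all add: H[of n] mult.commute)
    have "qform n Y' v = qform n Y v - (\<Sum>i<n. \<Sum>j<n. (cnj (v i) * Y i n) * (Y n j * v j) / d)"
      unfolding qform_def Y'_def sum_subtractf[symmetric]
      by (intro sum.cong refl) (simp add: algebra_simps)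
    also have "(\<Sum>i<n. \<Sum>j<n. (cnj (v i) * Y i n) * (Y n j * v j) / d) = cnj b * b / d"
      unfolding cb[symmetric] unfolding b_def sum_product by (simp only: sum_divide_distrib)
    finally have l: "qform n Y' v = qform n Y v - cnj b * b / d" .
    have eq: "qform n Y (v(n := - b / d)) = qform n Y v"
      by (rule qform_cong) auto
    have s: "(\<Sum>i<n. cnj ((v(n := - b / d)) i) * Y i n) = cnj b" "(\<Sum>j<n. Y n j * (v(n := - b / d)) j) = b"
      unfolding cb[symmetric] by (simp_all add: b_def)
    have "qform (Suc n) Y (v(n := - b / d)) = qform n Y v - cnj b * b / d"
      unfolding qform_Suc eq s by (cases "d = 0") (simp_all add: Ynn field_simps)
    with l show ?thesis by (simp add: b_def)
  qed
  have "psd_mat n Y'"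
    unfolding psd_mat_def
  proof (intro conjI allI)
    show "hermitian_mat n Y'"
      unfolding hermitian_mat_def Y'_def
    proof (intro allI impI)
      fix i j assume "i < n" "j < n"
      then have "Y j i = cnj (Y i j)" "Y j n = cnj (Y n j)" "Y n i = cnj (Y i n)"
        by (intro H; simp)+
      then show "Y j i - Y j n * Y n i / d = cnj (Y i j - Y i n * Y n j / d)"
        by simp
    qed
    show "Im (qform n Y' v) = 0" "0 \<le> Re (qform n Y' v)" for v
      using Suc.prems unfolding q by (auto simp: psd_mat_def)
  qed
  from Suc.IH[OF this] obtain V' where V': "\<And>i j. i < n \<Longrightarrow> j < n \<Longrightarrow> Y' i j = (\<Sum>k<n. V' i k * cnj (V' j k))"
    by blast
  \<comment> \<open>Columns below n come from the induction hypothesis, padded by zero in row n;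
    column n is the rescaled last column of \<open>Y\<close>.\<close>
  define V where "V i k = (if k < n then (if i < n then V' i k else 0) else Y i n / sqrt d)" for i k
  have sqd: "complex_of_real (sqrt d) * complex_of_real (sqrt d) = d"
    using d0 by (simp flip: of_real_mult)
  have V: "(\<Sum>k<Suc n. V i k * cnj (V j k))
      = (if i < n \<and> j < n then Y' i j else 0) + Y i n * cnj (Y j n) / d" for i j
  proof -
    have "(\<Sum>k<n. V i k * cnj (V j k)) = (if i < n \<and> j < n then Y' i j else 0)"
      by (auto simp: V_def V')
    then show ?thesis
      using sqd by (simp add: V_def)
  qed
  have zero: "d = 0 \<Longrightarrow> j < n \<Longrightarrow> Y n j = 0" for j
    using psd_mat_last_row_zero[OF Suc.prems, of j] Ynn by simp
  have "Y i j = (\<Sum>k<Suc n. V i k * cnj (V j k))" if "i < Suc n" "j < Suc n" for i j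
  proof -
    have c: "cnj (Y j n) = Y n j" using H[of j n] that by simp
    consider "i < n" "j < n" | "i = n" | "j = n" "i < n" using \<open>i < Suc n\<close> \<open>j < Suc n\<close> by linarith
    then show ?thesis
    proof cases
      case 1
      then show ?thesis unfolding V c by (simp add: Y'_def)
    next
      case 2
      then show ?thesis unfolding V c
        using zero[of j] that by (cases "d = 0"; cases "j = n") (auto simp: Ynn)
    next
      case 3
      then have "d = 0 \<Longrightarrow> Y i n = 0" using zero[of i] H[of n i] by simp
      then show ?thesis unfolding V c
        using 3 by (cases "d = 0") (auto simp: Ynn)
    qed
  qed
  then show ?case by blast
qed

section \<open>Stationarity and the dual certificate\<close>

definition bform :: "nat \<Rightarrow> (nat \<Rightarrow> nat \<Rightarrow> complex) \<Rightarrow> (nat \<Rightarrow> complex) \<Rightarrow> (nat \<Rightarrow> complex) \<Rightarrow> complex" where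
  "bform n A p q = (\<Sum>i<n. cnj (p i) * (\<Sum>j<n. A i j * q j))"

definition norm_sq :: "nat \<Rightarrow> (nat \<Rightarrow> complex) \<Rightarrow> real" where
  "norm_sq n v = (\<Sum>i<n. (cmod (v i))\<^sup>2)"

lemma norm_sq_nonneg [simp]: "0 \<le> norm_sq n v"
  by (simp add: norm_sq_def sum_nonneg)

lemma norm_sq_eq_0D: "norm_sq n v = 0 \<Longrightarrow> i < n \<Longrightarrow> v i = 0"
  unfolding norm_sq_def by (subst (asm) sum_nonneg_eq_0_iff) auto

lemma qform_eq_bform: "qform n A x = bform n A x x"
  by (simp add: qform_def bform_def sum_distrib_left mult.assoc)

lemma bform_add_left: "bform n A (\<lambda>i. p i + q i) r = bform n A p r + bform n A q r"
  by (simp add: bform_def sum.distrib algebra_simps)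

lemma bform_add_right: "bform n A r (\<lambda>i. p i + q i) = bform n A r p + bform n A r q"
  by (simp add: bform_def sum.distrib algebra_simps)

lemma bform_diff_left: "bform n A (\<lambda>i. p i - q i) r = bform n A p r - bform n A q r"
  by (simp add: bform_def sum_subtractf algebra_simps)

lemma bform_diff_right: "bform n A r (\<lambda>i. p i - q i) = bform n A r p - bform n A r q"
  by (simp add: bform_def sum_subtractf algebra_simps)

lemma bform_scale_left: "bform n A (\<lambda>i. c * p i) q = cnj c * bform n A p q"
  by (simp add: bform_def sum_distrib_left mult.assoc)

lemma bform_scale_right: "bform n A p (\<lambda>i. c * q i) = c * bform n A p q"
  by (simp add: bform_def sum_distrib_left mult_ac)

lemma bform_hermitian:
  assumes "hermitian_mat n A"
  shows "bform n A q p = cnj (bform n A p q)"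
proof -
  have "bform n A q p = (\<Sum>i<n. \<Sum>j<n. cnj (q i) * A i j * p j)"
    by (simp add: bform_def sum_distrib_left mult.assoc)
  also have "\<dots> = (\<Sum>j<n. \<Sum>i<n. cnj (q i) * A i j * p j)"
    by (rule sum.swap)
  also have "\<dots> = (\<Sum>j<n. \<Sum>i<n. cnj (cnj (p j) * (A j i * q i)))"
  proof (intro sum.cong refl)
    fix i j assume "i \<in> {..<n}" "j \<in> {..<n}"
    then have "A i j = cnj (A j i)"
      using assms unfolding hermitian_mat_def by blast
    then show "cnj (q i) * A i j * p j = cnj (cnj (p j) * (A j i * q i))"
      by simp
  qed
  finally show ?thesis
    by (simp add: bform_def sum_distrib_left)
qed

lemma norm_sq_add_sub:
  "norm_sq n (\<lambda>i. p i + q i) + norm_sq n (\<lambda>i. p i - q i) = 2 * norm_sq n p + 2 * norm_sq n q"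
  unfolding norm_sq_def sum.distrib[symmetric] sum_distrib_left cmod_power2
  by (intro sum.cong refl) (simp add: power2_eq_square algebra_simps)

lemma norm_sq_scale: "norm_sq n (\<lambda>i. c * v i) = (cmod c)\<^sup>2 * norm_sq n v"
  by (simp add: norm_sq_def sum_distrib_left norm_mult power_mult_distrib)

text \<open>Polarization and the parallelogram law bound the form by the mean of the two squared
  norms. Scaling \<open>p\<close> by the norm of \<open>q\<close> and conversely makes the norms
  equal, which turns the mean into their product.\<close>

lemma bform_bound:
  assumes A: "hermitian_mat n A" and L: "\<And>v. \<bar>Re (qform n A v)\<bar> \<le> L * norm_sq n v"
  shows "\<bar>Re (bform n A p q)\<bar> \<le> L * sqrt (norm_sq n p) * sqrt (norm_sq n q)"
proof -
  have pol: "2 * \<bar>Re (bform n A p q)\<bar> \<le> L * (norm_sq n p + norm_sq n q)" for p q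
  proof -
    have "Re (qform n A (\<lambda>i. p i + q i)) - Re (qform n A (\<lambda>i. p i - q i)) = 4 * Re (bform n A p q)"
      by (simp add: qform_eq_bform bform_add_left bform_add_right bform_diff_left bform_diff_right
          bform_hermitian[OF A, of q p])
    then have "4 * \<bar>Re (bform n A p q)\<bar> \<le> L * (norm_sq n (\<lambda>i. p i + q i) + norm_sq n (\<lambda>i. p i - q i))"
      using L[of "\<lambda>i. p i + q i"] L[of "\<lambda>i. p i - q i"] by (simp add: algebra_simps)
    then show ?thesis unfolding norm_sq_add_sub by (simp add: algebra_simps)
  qed
  define a where "a = sqrt (norm_sq n p)"
  define b where "b = sqrt (norm_sq n q)"
  have ab: "a\<^sup>2 = norm_sq n p" "b\<^sup>2 = norm_sq n q" "a \<ge> 0" "b \<ge> 0"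
    by (auto simp: a_def b_def)
  show ?thesis
  proof (cases "a = 0 \<or> b = 0")
    case True
    then have "(\<forall>i<n. p i = 0) \<or> (\<forall>i<n. q i = 0)"
      using ab norm_sq_eq_0D by (metis zero_power2)
    then have "bform n A p q = 0"
      by (auto simp: bform_def)
    then show ?thesis using True unfolding a_def[symmetric] b_def[symmetric] by auto
  next
    case False
    then have pos: "a * b > 0" using ab by auto
    let ?p = "\<lambda>i. complex_of_real b * p i" and ?q = "\<lambda>i. complex_of_real a * q i"
    have "bform n A ?p ?q = complex_of_real (a * b) * bform n A p q"
      unfolding bform_scale_left bform_scale_right by simp
    then have "Re (bform n A ?p ?q) = a * b * Re (bform n A p q)"
      by simp
    then have "2 * (a * b * \<bar>Re (bform n A p q)\<bar>) \<le> L * (2 * (a\<^sup>2 * b\<^sup>2))"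
      using pol[of ?p ?q] pos by (simp add: norm_sq_scale ab(1,2)[symmetric] ab(3,4) abs_mult mult.commute)
    then have "a * b * \<bar>Re (bform n A p q)\<bar> \<le> a * b * (L * a * b)"
      by (simp add: power2_eq_square algebra_simps)
    then show ?thesis
      unfolding a_def[symmetric] b_def[symmetric] by (simp only: mult_le_cancel_left_pos[OF pos])
  qed
qed

lemma cnj_sgn_mult: "cnj (sgn y) * y = complex_of_real (cmod y)"
proof (cases "y = 0")
  case False
  have "cnj y * y = complex_of_real (cmod y) * complex_of_real (cmod y)"
    using complex_norm_square[of y] by (simp add: power2_eq_square mult.commute)
  then show ?thesis using False by (simp add: sgn_eq)
qed simp

text \<open>Apply \<open>bform_bound\<close> to the unit vector at \<open>i\<close> carrying the
  phase of the row sum; the phase 1 at \<open>y = 0\<close> keeps its norm equal to 1.\<close>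

lemma row_bound:
  assumes A: "hermitian_mat n A" and L: "\<And>v. \<bar>Re (qform n A v)\<bar> \<le> L * norm_sq n v" and i: "i < n"
  shows "cmod (\<Sum>j<n. A i j * q j) \<le> L * sqrt (norm_sq n q)"
proof -
  define y where "y = (\<Sum>j<n. A i j * q j)"
  define p where "p = (\<lambda>k. if k = i then (if y = 0 then 1 else sgn y) else 0)"
  have "bform n A p q = (\<Sum>k<n. if k = i then cnj (p i) * y else 0)"
    unfolding bform_def by (intro sum.cong) (auto simp: p_def y_def)
  then have "bform n A p q = cnj (p i) * y"
    using i by simp
  also have "\<dots> = complex_of_real (cmod y)"
    by (cases "y = 0") (simp_all add: p_def cnj_sgn_mult)
  finally have 1: "bform n A p q = complex_of_real (cmod y)" .
  have "norm_sq n p = (\<Sum>k<n. if k = i then 1 else 0)"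
    unfolding norm_sq_def by (intro sum.cong) (auto simp: p_def norm_sgn)
  then have "norm_sq n p = 1" using i by simp
  then show ?thesis
    using bform_bound[OF A L, of p q] 1 by (simp add: y_def)
qed

lemma cinner_bound: "cmod (cinner n u v) \<le> sqrt (norm_sq n u) * sqrt (norm_sq n v)"
proof -
  have "cmod (cinner n u v) \<le> (\<Sum>i<n. \<bar>cmod (u i)\<bar> * \<bar>cmod (v i)\<bar>)"
    unfolding cinner_def by (rule order_trans[OF norm_sum]) (simp add: norm_mult)
  also have "\<dots> \<le> L2_set (\<lambda>i. cmod (u i)) {..<n} * L2_set (\<lambda>i. cmod (v i)) {..<n}"
    by (rule L2_set_mult_ineq)
  finally show ?thesis by (simp add: L2_set_def norm_sq_def)
qed

text \<open>Replace only the i-th coordinate of \<open>x\<close> by the phase of (C x)_i. The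
  second-order term is nonnegative because \<open>C i i\<close> is, so optimality bounds the
  first-order term. No derivative is taken, and the multiplier comes out nonnegative.\<close>

lemma global_opt_stationary:
  assumes C: "hermitian_mat n C" and i: "i < n" and Cii: "0 \<le> Re (C i i)"
    and x: "is_global_opt n C x"
  shows "(\<Sum>j<n. C i j * x j) = complex_of_real (cmod (\<Sum>j<n. C i j * x j)) * x i"
proof -
  define y where "y = (\<Sum>j<n. C i j * x j)"
  define u where "u = (if y = 0 then 1 else sgn y)"
  have u: "cmod u = 1" "cnj u * y = complex_of_real (cmod y)"
  proof -
    show "cmod u = 1" by (simp add: u_def norm_sgn)
    show "cnj u * y = complex_of_real (cmod y)"
      by (cases "y = 0") (simp_all add: u_def cnj_sgn_mult)
  qed
  define \<delta> where "\<delta> = u - x i"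
  define e where "e = (\<lambda>k. if k = i then \<delta> else 0)"
  have xi: "cmod (x i) = 1" using x i by (simp add: is_global_opt_def unimod_def)
  have b: "bform n C e q = cnj \<delta> * (\<Sum>j<n. C i j * q j)" for q
  proof -
    have "bform n C e q = (\<Sum>k<n. if k = i then cnj \<delta> * (\<Sum>j<n. C i j * q j) else 0)"
      unfolding bform_def by (intro sum.cong) (auto simp: e_def)
    then show ?thesis using i by simp
  qed
  have Ce: "(\<Sum>j<n. C i j * e j) = C i i * \<delta>"
  proof -
    have "(\<Sum>j<n. C i j * e j) = (\<Sum>k<n. if k = i then C i i * \<delta> else 0)"
      by (intro sum.cong) (auto simp: e_def)
    then show ?thesis using i by simp
  qed
  have "unimod n (\<lambda>k. x k + e k)"
    using x u(1) by (auto simp: unimod_def is_global_opt_def e_def \<delta>_def)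
  then have "Re (qform n C (\<lambda>k. x k + e k)) \<le> Re (qform n C x)"
    using x by (simp add: is_global_opt_def)
  also have "Re (qform n C (\<lambda>k. x k + e k)) = Re (qform n C x) + 2 * Re (cnj \<delta> * y) + Re (cnj \<delta> * (C i i * \<delta>))"
    unfolding qform_eq_bform bform_add_left bform_add_right bform_hermitian[OF C, of x e] b Ce y_def[symmetric]
    by simp
  also have "cnj \<delta> * (C i i * \<delta>) = complex_of_real ((cmod \<delta>)\<^sup>2) * C i i"
    using complex_norm_square[of \<delta>] by (simp add: mult_ac)
  finally have "Re (cnj \<delta> * y) \<le> 0"
    using mult_nonneg_nonneg[OF zero_le_power2 Cii, of "cmod \<delta>"] by simp
  moreover have "Re (cnj \<delta> * y) = cmod y - Re (cnj (x i) * y)"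
    unfolding \<delta>_def complex_cnj_diff left_diff_distrib minus_complex.sel u(2) by simp
  ultimately have le: "cmod y \<le> Re (cnj (x i) * y)" by simp
  \<comment> \<open>Equality case of |Re (cnj (x i) * y)| <= |y|: the squared distance expands to a
    nonpositive number.\<close>
  have "(cmod (y - complex_of_real (cmod y) * x i))\<^sup>2
     = (cmod y)\<^sup>2 + (cmod y)\<^sup>2 * (cmod (x i))\<^sup>2 - 2 * cmod y * Re (cnj (x i) * y)"
    unfolding cmod_power2[of "y - complex_of_real (cmod y) * x i"] cmod_power2[of "x i"]
    by (simp add: power2_eq_square algebra_simps) (simp add: cmod_power2[of y, unfolded power2_eq_square])
  also have "\<dots> = 2 * (cmod y * (cmod y - Re (cnj (x i) * y)))"
    by (simp add: xi power2_eq_square algebra_simps)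
  also have "\<dots> \<le> 0"
    using le by (simp add: mult_nonneg_nonpos)
  finally have "y = complex_of_real (cmod y) * x i"
    by simp
  then show ?thesis by (simp add: y_def)
qed

section \<open>Dual certificate for the semidefinite program\<close>

lemma sdp_feasible_rank_one:
  assumes "unimod n x"
  shows "sdp_feasible n (\<lambda>i j. x i * cnj (x j))"
proof -
  have q: "qform n (\<lambda>i j. x i * cnj (x j)) v = complex_of_real ((cmod (cinner n x v))\<^sup>2)" for v
  proof -
    have "qform n (\<lambda>i j. x i * cnj (x j)) v = cnj (cinner n x v) * cinner n x v"
      unfolding qform_def cinner_def cnj_sum sum_product by (simp add: mult_ac)
    then show ?thesis by (simp only: complex_norm_square mult.commute)
  qed
  have "x i * cnj (x i) = 1" if "i < n" for i
    using assms that complex_norm_square[of "x i"] by (simp add: unimod_def)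
  then show ?thesis
    unfolding sdp_feasible_def psd_mat_def hermitian_mat_def q by auto
qed

text \<open>Complementary slackness: the slack matrix diag(\<open>\<mu>\<close>) - C annihilates \<open>x\<close> and is positive
  on its orthogonal complement.\<close>
lemma sdp_unique_solution_of_dual_certificate:
  assumes n: "n > 0" and C: "hermitian_mat n C" and x: "unimod n x"
    and \<mu>: "\<And>i. i < n \<Longrightarrow> (\<Sum>j<n. C i j * x j) = complex_of_real (\<mu> i) * x i"
    and pos: "\<And>u. cinner n x u = 0 \<Longrightarrow> norm_sq n u > 0 \<Longrightarrow> Re (qform n C u) < (\<Sum>i<n. \<mu> i * (cmod (u i))\<^sup>2)"
  shows "sdp_unique_solution n C (\<lambda>i j. x i * cnj (x j))"
  unfolding sdp_unique_solution_def
proof (intro conjI allI impI sdp_feasible_rank_one x)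
  \<comment> \<open>The quadratic form of the slack matrix.\<close>
  define D where "D v = (\<Sum>i<n. \<mu> i * (cmod (v i))\<^sup>2) - Re (qform n C v)" for v
  have xx: "cnj (x i) * x i = 1" if "i < n" for i
    using x that complex_norm_square[of "x i"] by (simp add: unimod_def mult.commute)
  have Bx: "bform n C p x = (\<Sum>i<n. complex_of_real (\<mu> i) * (cnj (p i) * x i))" for p
    unfolding bform_def by (intro sum.cong) (auto simp: \<mu>)
  \<comment> \<open>The subtracted vector is the projection of \<open>v\<close> onto
    \<open>x\<close>, whose squared norm is \<open>n\<close>; the form is unchanged because the
    slack matrix annihilates \<open>x\<close>.\<close>
  have decomp: "D v = D (\<lambda>i. v i - cinner n x v / n * x i)" and orth: "cinner n x (\<lambda>i. v i - cinner n x v / n * x i) = 0" for v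
  proof -
    define \<beta> where "\<beta> = cinner n x v / n"
    have "cinner n x (\<lambda>i. \<beta> * x i) = (\<Sum>i<n. \<beta> * (cnj (x i) * x i))"
      unfolding cinner_def by (intro sum.cong) auto
    also have "\<dots> = (\<Sum>i<n. \<beta>)"
      by (intro sum.cong) (auto simp: xx)
    also have "\<dots> = cinner n x v"
      using n by (simp add: \<beta>_def)
    finally show "cinner n x (\<lambda>i. v i - cinner n x v / n * x i) = 0"
      by (simp add: \<beta>_def[symmetric]) (simp add: cinner_def right_diff_distrib sum_subtractf)
    have 1: "Re (qform n C (\<lambda>i. v i - \<beta> * x i)) = Re (qform n C v)
       - 2 * Re (\<beta> * bform n C v x) + Re (cnj \<beta> * (\<beta> * bform n C x x))"
      unfolding qform_eq_bform bform_diff_left bform_diff_right bform_scale_left bform_scale_right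
        bform_hermitian[OF C, of x v] by simp
    have 2: "Re (\<beta> * bform n C v x) = (\<Sum>i<n. \<mu> i * Re (\<beta> * (cnj (v i) * x i)))"
      unfolding Bx sum_distrib_left Re_sum
      by (intro sum.cong refl) (simp add: mult.left_commute[of \<beta>])
    have 3: "Re (cnj \<beta> * (\<beta> * bform n C x x)) = (\<Sum>i<n. \<mu> i * (cmod \<beta>)\<^sup>2)"
    proof -
      have "bform n C x x = (\<Sum>i<n. complex_of_real (\<mu> i))"
        unfolding Bx by (intro sum.cong) (auto simp: xx)
      moreover have *: "cnj \<beta> * (\<beta> * z) = complex_of_real ((cmod \<beta>)\<^sup>2) * z" for z
        using complex_norm_square[of \<beta>] by (simp add: mult_ac)
      ultimately have "cnj \<beta> * (\<beta> * bform n C x x) = complex_of_real ((cmod \<beta>)\<^sup>2 * (\<Sum>i<n. \<mu> i))"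
        unfolding * by simp
      then show ?thesis
        by (simp add: sum_distrib_right mult.commute)
    qed
    have 4: "(cmod (v i - \<beta> * x i))\<^sup>2 = (cmod (v i))\<^sup>2 - 2 * Re (\<beta> * (cnj (v i) * x i)) + (cmod \<beta>)\<^sup>2" if "i < n" for i
    proof -
      have "(cmod (v i - \<beta> * x i))\<^sup>2 = (cmod (v i))\<^sup>2 - 2 * Re (cnj (v i) * (\<beta> * x i)) + (cmod (\<beta> * x i))\<^sup>2"
        unfolding cmod_power2[of "v i - _"] cmod_power2[of "v i"] cmod_power2[of "\<beta> * x i"]
        by (simp only: minus_complex.sel) (simp add: power2_eq_square algebra_simps)
      then show ?thesis
        using x that by (simp only: unimod_def norm_mult mult_1_right mult.left_commute)
    qed
    have "(\<Sum>i<n. \<mu> i * (cmod (v i - \<beta> * x i))\<^sup>2) = (\<Sum>i<n. \<mu> i * (cmod (v i))\<^sup>2)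
       - 2 * (\<Sum>i<n. \<mu> i * Re (\<beta> * (cnj (v i) * x i))) + (\<Sum>i<n. \<mu> i * (cmod \<beta>)\<^sup>2)"
      unfolding sum_distrib_left sum_subtractf[symmetric] sum.distrib[symmetric]
      by (intro sum.cong refl) (simp only: lessThan_iff 4, simp only: algebra_simps)
    then show "D v = D (\<lambda>i. v i - cinner n x v / n * x i)"
      unfolding D_def \<beta>_def[symmetric] using 1 2 3 by linarith
  qed
  have Dpos: "0 \<le> D v" and Dzero: "D v = 0 \<Longrightarrow> i < n \<Longrightarrow> v i = cinner n x v / n * x i" for v i
  proof -
    define u where "u = (\<lambda>i. v i - cinner n x v / n * x i)"
    have D: "D v = D u" and o: "cinner n x u = 0"
      using decomp[of v] orth[of v] by (simp_all add: u_def)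
    have gt: "norm_sq n u > 0 \<Longrightarrow> D u > 0"
      using pos[OF o] by (simp add: D_def)
    have zero: "u i = 0" if "\<not> norm_sq n u > 0" "i < n" for i
      using that norm_sq_eq_0D[of n u i] norm_sq_nonneg[of n u] by linarith
    have "D u = 0" if "\<not> norm_sq n u > 0"
      using zero[OF that] by (simp add: D_def qform_def)
    with gt show "0 \<le> D v" unfolding D by fastforce
    show "v i = cinner n x v / n * x i" if "D v = 0" "i < n"
      using that gt zero[of i] unfolding D by (auto simp: u_def)
  qed
  fix Y assume Y: "sdp_feasible n Y"
    and opt: "Re (trace_prod n C (\<lambda>i j. x i * cnj (x j))) \<le> Re (trace_prod n C Y)"
  then obtain V where V: "\<And>i j. i < n \<Longrightarrow> j < n \<Longrightarrow> Y i j = (\<Sum>k<n. V i k * cnj (V j k))"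
    using psd_mat_decomposition[of n Y] unfolding sdp_feasible_def by blast
  define v where "v k = (\<lambda>i. V i k)" for k
  have trY: "trace_prod n C Y = (\<Sum>k<n. qform n C (v k))"
  proof -
    have "trace_prod n C Y = (\<Sum>i<n. \<Sum>j<n. \<Sum>k<n. cnj (V i k) * C i j * V j k)"
      unfolding trace_prod_def by (intro sum.cong refl) (simp add: V sum_distrib_left mult_ac)
    also have "\<dots> = (\<Sum>i<n. \<Sum>k<n. \<Sum>j<n. cnj (V i k) * C i j * V j k)"
      by (rule sum.cong[OF refl]) (rule sum.swap)
    also have "\<dots> = (\<Sum>k<n. qform n C (v k))"
      unfolding qform_def v_def by (rule sum.swap)
    finally show ?thesis .
  qed
  have trx: "trace_prod n C (\<lambda>i j. x i * cnj (x j)) = (\<Sum>i<n. complex_of_real (\<mu> i))"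
  proof -
    have "trace_prod n C (\<lambda>i j. x i * cnj (x j)) = bform n C x x"
      by (simp add: trace_prod_def bform_def sum_distrib_left mult_ac)
    also have "\<dots> = (\<Sum>i<n. complex_of_real (\<mu> i))"
      unfolding Bx by (intro sum.cong) (auto simp: xx)
    finally show ?thesis .
  qed
  have diag: "(\<Sum>k<n. (cmod (V i k))\<^sup>2) = 1" if "i < n" for i
  proof -
    have "complex_of_real (\<Sum>k<n. (cmod (V i k))\<^sup>2) = Y i i"
      unfolding V[OF that that] of_real_sum by (intro sum.cong refl) (rule complex_norm_square)
    also have "\<dots> = 1" using Y that by (simp add: sdp_feasible_def)
    finally show ?thesis by (metis of_real_eq_1_iff)
  qed
  \<comment> \<open>The sum of slack forms over the columns of the factor is the objective at x x^*
    minus the objective at \<open>Y\<close>, because the diagonal of \<open>Y\<close> is 1. By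
    \<open>opt\<close> it is at most 0, so every column lies on the line through
    \<open>x\<close>.\<close>
  have "(\<Sum>k<n. D (v k)) = (\<Sum>k<n. \<Sum>i<n. \<mu> i * (cmod (V i k))\<^sup>2) - Re (trace_prod n C Y)"
    by (simp add: D_def sum_subtractf trY v_def)
  also have "(\<Sum>k<n. \<Sum>i<n. \<mu> i * (cmod (V i k))\<^sup>2) = (\<Sum>i<n. \<mu> i * (\<Sum>k<n. (cmod (V i k))\<^sup>2))"
    unfolding sum_distrib_left by (rule sum.swap)
  also have "\<dots> = Re (trace_prod n C (\<lambda>i j. x i * cnj (x j)))"
    unfolding trx by (simp add: diag)
  finally have "(\<Sum>k<n. D (v k)) = 0"
    using opt sum_nonneg[of "{..<n}" "\<lambda>k. D (v k)"] Dpos by simp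
  then have "D (v k) = 0" if "k < n" for k
    using that Dpos by (subst (asm) sum_nonneg_eq_0_iff) auto
  then have vk: "V i k = cinner n x (v k) / n * x i" if "k < n" "i < n" for i k
    using Dzero[of "v k" i] that by (simp add: v_def)
  define \<beta> where "\<beta> k = cinner n x (v k) / n" for k
  have Yij: "Y i j = (\<Sum>k<n. \<beta> k * cnj (\<beta> k)) * (x i * cnj (x j))" if "i < n" "j < n" for i j
    unfolding V[OF that] sum_distrib_right
    by (intro sum.cong refl) (use that in \<open>simp add: vk \<beta>_def[symmetric] mult_ac\<close>)
  \<comment> \<open>The scalar is read off from the diagonal entry with index 0.\<close>
  have "(\<Sum>k<n. \<beta> k * cnj (\<beta> k)) = 1"
    using Yij[OF n n] xx[OF n] Y n by (simp add: sdp_feasible_def mult.commute)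
  then show "Y i j = x i * cnj (x j)" if "i < n" "j < n" for i j
    using Yij[OF that] by simp
qed

section \<open>Deterministic error bounds\<close>

lemma ln_le_two_sqrt: "x > 0 \<Longrightarrow> ln x \<le> 2 * sqrt (x::real)"
proof -
  assume x: "x > 0"
  then have "ln x = 2 * ln (sqrt x)"
    by (simp add: ln_sqrt)
  also have "\<dots> \<le> 2 * sqrt x"
    using less_imp_le[OF ln_less_self[of "sqrt x"]] x by simp
  finally show ?thesis .
qed

text \<open>Taking moduli gives |s - \<mu>| <= |\<eta>|, and s (x - z) = (s - \<mu>) x + \<eta>;
  each summand costs one |\<eta>|.\<close>

lemma norm_unit_diff_le:
  assumes "cmod x = 1" "cmod z = 1" "s \<ge> 0" "\<mu> \<ge> 0" and eq: "complex_of_real \<mu> * x = complex_of_real s * z + \<eta>"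
  shows "s * cmod (x - z) \<le> 2 * cmod \<eta>"
proof -
  have "\<mu> = cmod (complex_of_real s * z + \<eta>)"
    using assms by (simp add: norm_mult flip: eq)
  moreover have "cmod (complex_of_real s * z) = s"
    using assms by (simp add: norm_mult)
  ultimately have "\<bar>s - \<mu>\<bar> \<le> cmod \<eta>"
    using norm_triangle_ineq[of "complex_of_real s * z" \<eta>] norm_diff_ineq[of "complex_of_real s * z" \<eta>]
    by linarith
  then have "cmod (complex_of_real (s - \<mu>) * x) \<le> cmod \<eta>"
    using assms by (simp add: norm_mult del: of_real_diff)
  moreover have "complex_of_real s * (x - z) = complex_of_real (s - \<mu>) * x + \<eta>"
    using eq by (simp add: algebra_simps)
  then have "s * cmod (x - z) = cmod (complex_of_real (s - \<mu>) * x + \<eta>)"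
    using assms by (metis norm_mult norm_of_real abs_of_nonneg)
  ultimately show ?thesis
    using norm_triangle_ineq[of "complex_of_real (s - \<mu>) * x" \<eta>] by linarith
qed

lemma qform_signal_plus_noise:
  "Re (qform n (\<lambda>i j. z i * cnj (z j) + complex_of_real \<sigma> * M i j) x) = (cmod (cinner n z x))\<^sup>2 + \<sigma> * Re (qform n M x)"
proof -
  have "qform n (\<lambda>i j. z i * cnj (z j) + complex_of_real \<sigma> * M i j) x
     = (\<Sum>i<n. \<Sum>j<n. cnj (x i) * z i * (cnj (z j) * x j)) + complex_of_real \<sigma> * qform n M x"
    unfolding qform_def sum_distrib_left sum.distrib[symmetric]
    by (intro sum.cong refl) (simp add: algebra_simps)
  also have "(\<Sum>i<n. \<Sum>j<n. cnj (x i) * z i * (cnj (z j) * x j)) = cnj (cinner n z x) * cinner n z x"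
    unfolding cinner_def cnj_sum sum_product by (simp add: mult_ac)
  also have "\<dots> = complex_of_real ((cmod (cinner n z x))\<^sup>2)"
    by (simp only: complex_norm_square mult.commute)
  finally show ?thesis by simp
qed

section \<open>Deterministic analysis for a fixed noise matrix on the good event\<close>

context
  fixes n :: nat and z x :: "nat \<Rightarrow> complex" and M C :: "nat \<Rightarrow> nat \<Rightarrow> complex" and \<sigma> s :: real
  assumes n: "n \<ge> 100" and \<sigma>: "\<sigma> \<ge> 0" and z: "unimod n z"
    and M: "hermitian_mat n M" and Mdiag: "\<And>i. i < n \<Longrightarrow> M i i = 0"
    and Mq: "\<And>v. \<bar>Re (qform n M v)\<bar> \<le> 4 * sqrt n * norm_sq n v"
    and Mz: "\<And>i. i < n \<Longrightarrow> cmod (\<Sum>j<n. M i j * z j) \<le> 5/2 * sqrt (real n * ln n)"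
  defines "C \<equiv> \<lambda>i j. z i * cnj (z j) + complex_of_real \<sigma> * M i j"
  assumes opt: "is_global_opt n C x" and phase: "cinner n z x = complex_of_real (cmod (cinner n z x))"
  defines "s \<equiv> cmod (cinner n z x)"
begin

lemma sqrt_dimension: "sqrt n * sqrt n = real n" "sqrt n \<ge> 10" "10 * sqrt n \<le> real n"
proof -
  show 1: "sqrt n * sqrt n = real n" by simp
  show 2: "sqrt n \<ge> 10" using n by (intro real_le_rsqrt) auto
  show "10 * sqrt n \<le> real n" using mult_right_mono[OF 2, of "sqrt n"] 1 by simp
qed

lemma unimod_opt: "unimod n x"
  using opt by (simp add: is_global_opt_def)

text \<open>The phase condition makes z^* x the real number \<open>s\<close>, so both squared norms
  are affine in \<open>s\<close>.\<close>

lemma norm_sq_diff_sum: "norm_sq n (\<lambda>i. x i - z i) = 2 * n - 2 * s" "norm_sq n (\<lambda>i. x i + z i) = 2 * n + 2 * s"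
proof -
  have s: "(\<Sum>i<n. Re (cnj (z i) * x i)) = s"
    using arg_cong[OF phase, of Re] by (simp add: cinner_def s_def)
  have u: "(cmod (x i))\<^sup>2 = 1" "(cmod (z i))\<^sup>2 = 1" if "i < n" for i
    using that z unimod_opt by (auto simp: unimod_def)
  have "(cmod (x i - z i))\<^sup>2 = 2 - 2 * Re (cnj (z i) * x i)" if "i < n" for i
    using u[OF that] unfolding cmod_power2 by (simp add: power2_eq_square algebra_simps)
  then show "norm_sq n (\<lambda>i. x i - z i) = 2 * n - 2 * s"
    unfolding norm_sq_def s[symmetric] by (simp add: sum_subtractf sum_distrib_left)
  have "(cmod (x i + z i))\<^sup>2 = 2 + 2 * Re (cnj (z i) * x i)" if "i < n" for i
    using u[OF that] unfolding cmod_power2 by (simp add: power2_eq_square algebra_simps)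
  then show "norm_sq n (\<lambda>i. x i + z i) = 2 * n + 2 * s"
    unfolding norm_sq_def s[symmetric] by (simp add: sum.distrib sum_distrib_left)
qed

text \<open>Comparing \<open>x\<close> with \<open>z\<close> gives \<open>n\<^sup>2 - s\<^sup>2 \<le> \<sigma> Re ((x - z)\<^sup>* M (x + z))\<close>, and
  \<open>4 (n\<^sup>2 - s\<^sup>2)\<close> is the product of \<open>\<parallel>x - z\<parallel>\<^sup>2\<close> and \<open>\<parallel>x + z\<parallel>\<^sup>2\<close>.\<close>
lemma l2_error: "sqrt (norm_sq n (\<lambda>i. x i - z i)) \<le> 12 * \<sigma>"
proof -
  define a where "a = sqrt (norm_sq n (\<lambda>i. x i - z i))"
  define b where "b = sqrt (norm_sq n (\<lambda>i. x i + z i))"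
  have s0: "s \<ge> 0" by (simp add: s_def)
  have ab: "a\<^sup>2 = 2 * n - 2 * s" "b\<^sup>2 = 2 * n + 2 * s" "a \<ge> 0" "b \<ge> 0"
    unfolding a_def b_def real_sqrt_pow2[OF norm_sq_nonneg]
    by (rule norm_sq_diff_sum real_sqrt_ge_zero norm_sq_nonneg)+
  have "cinner n z z = (\<Sum>i<n. 1)"
    unfolding cinner_def using z by (intro sum.cong refl) (simp add: unimod_def complex_norm_square[symmetric] mult.commute[of "cnj _"])
  then have zz: "cmod (cinner n z z) = n" by simp
  have "Re (qform n C z) \<le> Re (qform n C x)"
    using opt z by (simp add: is_global_opt_def)
  then have "(real n)\<^sup>2 - s\<^sup>2 \<le> \<sigma> * (Re (qform n M x) - Re (qform n M z))"
    unfolding C_def qform_signal_plus_noise zz s_def by (simp add: algebra_simps)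
  \<comment> \<open>The mixed terms are conjugates of each other and cancel in the real
    part.\<close>
  also have "Re (qform n M x) - Re (qform n M z) = Re (bform n M (\<lambda>i. x i - z i) (\<lambda>i. x i + z i))"
    unfolding qform_eq_bform bform_diff_left bform_add_right bform_hermitian[OF M, of z x] by simp
  also have "\<sigma> * \<dots> \<le> \<sigma> * (4 * sqrt n * a * b)"
    using bform_bound[OF M Mq, of "\<lambda>i. x i - z i" "\<lambda>i. x i + z i"] \<sigma>
    by (intro mult_left_mono) (auto simp: a_def b_def)
  also have "(real n)\<^sup>2 - s\<^sup>2 = (a * b)\<^sup>2 / 4"
    unfolding power_mult_distrib ab by (simp add: power2_eq_square algebra_simps)
  finally have "(a * b) * (a * b) \<le> (16 * \<sigma> * sqrt n) * (a * b)"
    by (simp add: power2_eq_square algebra_simps)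
  then have le: "a * b \<le> 16 * \<sigma> * sqrt n"
    using ab \<sigma> by (cases "a * b = 0") (auto simp: mult_le_cancel_right)
  \<comment> \<open>From b^2 >= 2n and 16/9 <= 2; dividing 16 by 4/3 produces the constant
    12.\<close>
  have "sqrt n * (4 / 3) \<le> b"
  proof (rule power2_le_imp_le)
    show "(sqrt n * (4 / 3))\<^sup>2 \<le> b\<^sup>2"
      unfolding ab using s0 by (simp add: power_mult_distrib power2_eq_square)
  qed (use ab in auto)
  then have "a * (sqrt n * (4 / 3)) \<le> 16 * \<sigma> * sqrt n"
    using le mult_left_mono[of _ b a] ab by fastforce
  then have "sqrt n * a \<le> sqrt n * (12 * \<sigma>)"
    by (simp add: algebra_simps)
  then show ?thesis
    using sqrt_dimension unfolding a_def[symmetric] by simp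
qed

lemma correlation_lower_bound: "s \<ge> n - 72 * \<sigma>\<^sup>2"
proof -
  have "norm_sq n (\<lambda>i. x i - z i) \<le> (12 * \<sigma>)\<^sup>2"
    using l2_error \<sigma> by (metis norm_sq_nonneg real_sqrt_le_iff real_sqrt_abs abs_of_nonneg mult_nonneg_nonneg zero_le_numeral)
  then show ?thesis
    unfolding norm_sq_diff_sum by (simp add: power_mult_distrib)
qed

text \<open>Since \<open>x\<close> depends on the noise, the Chernoff bound is available only at the
  deterministic \<open>z\<close>. The remainder M (x - z) is controlled by the form bound and
  \<open>l2_error\<close>, with 48 = 4 * 12.\<close>

lemma noise_row_bound:
  assumes i: "i < n"
  shows "cmod (\<Sum>j<n. M i j * x j) \<le> 5/2 * sqrt (real n * ln n) + 48 * \<sigma> * sqrt n"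
proof -
  have "(\<Sum>j<n. M i j * x j) = (\<Sum>j<n. M i j * z j) + (\<Sum>j<n. M i j * (x j - z j))"
    by (simp add: sum.distrib[symmetric] algebra_simps)
  moreover have "cmod (\<Sum>j<n. M i j * (x j - z j)) \<le> 4 * sqrt n * sqrt (norm_sq n (\<lambda>j. x j - z j))"
    by (rule row_bound[OF M Mq i])
  moreover have "4 * sqrt n * sqrt (norm_sq n (\<lambda>j. x j - z j)) \<le> 4 * sqrt n * (12 * \<sigma>)"
    using l2_error by (intro mult_left_mono) auto
  ultimately show ?thesis
    using Mz[OF i] norm_triangle_ineq[of "\<Sum>j<n. M i j * z j" "\<Sum>j<n. M i j * (x j - z j)"]
    by (simp add: algebra_simps)
qed

lemma hermitian_C: "hermitian_mat n C"
  unfolding hermitian_mat_def C_def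
proof (intro allI impI)
  fix i j assume "i < n" "j < n"
  then have "M j i = cnj (M i j)" using M unfolding hermitian_mat_def by blast
  then show "z j * cnj (z i) + complex_of_real \<sigma> * M j i = cnj (z i * cnj (z j) + complex_of_real \<sigma> * M i j)"
    by simp
qed

lemma C_mult_opt: "(\<Sum>j<n. C i j * x j) = complex_of_real s * z i + complex_of_real \<sigma> * (\<Sum>j<n. M i j * x j)"
proof -
  have "(\<Sum>j<n. C i j * x j) = z i * cinner n z x + complex_of_real \<sigma> * (\<Sum>j<n. M i j * x j)"
    unfolding C_def cinner_def sum_distrib_left sum.distrib[symmetric]
    by (intro sum.cong refl) (simp add: algebra_simps)
  then show ?thesis
    using phase by (simp add: s_def mult.commute)
qed

lemma stationary:
  assumes "i < n"
  shows "(\<Sum>j<n. C i j * x j) = complex_of_real (cmod (\<Sum>j<n. C i j * x j)) * x i"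
proof (rule global_opt_stationary[OF hermitian_C assms _ opt])
  show "0 \<le> Re (C i i)"
    using Mdiag[OF assms] by (simp add: C_def complex_mult_cnj)
qed

text \<open>By stationarity \<open>x i\<close> is the phase of s z_i plus a noise term, so
  \<open>norm_unit_diff_le\<close> applies once \<open>s\<close> is comparable to
  \<open>n\<close>.\<close>

lemma sup_error:
  assumes i: "i < n"
  shows "cmod (x i - z i) \<le> 6 * (sqrt (ln (real n)) + 29 * \<sigma>) * \<sigma> / sqrt (real n)"
proof -
  have xz: "cmod (x i) = 1" "cmod (z i) = 1"
    using z unimod_opt i by (auto simp: unimod_def)
  have lnn: "0 \<le> sqrt (ln (real n))" using n by simp
  have sn: "sqrt n > 0" using sqrt_dimension by linarith
  \<comment> \<open>For large noise the claimed bound is at least 174 \<sigma>^2 / sqrt n >= 2, the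
    diameter of the unit circle; here 174 = 6 * 29 = 2 * 87.\<close>
  show ?thesis
  proof (cases "87 * \<sigma>\<^sup>2 \<ge> sqrt n")
    case True
    have "cmod (x i - z i) \<le> 2"
      using norm_triangle_ineq4[of "x i" "z i"] xz by simp
    also have "2 \<le> 174 * \<sigma>\<^sup>2 / sqrt n"
      using True sn by (simp add: field_simps)
    also have "\<dots> \<le> 6 * (sqrt (ln (real n)) + 29 * \<sigma>) * \<sigma> / sqrt (real n)"
      using lnn \<sigma> by (intro divide_right_mono) (auto simp: power2_eq_square algebra_simps)
    finally show ?thesis .
  next
    case False
    then have "72 * \<sigma>\<^sup>2 \<le> sqrt n"
      using zero_le_power2[of \<sigma>] by linarith
    then have s: "s \<ge> 9/10 * n"
      using correlation_lower_bound sqrt_dimension(3) by linarith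
    define \<eta> where "\<eta> = complex_of_real \<sigma> * (\<Sum>j<n. M i j * x j)"
    have eq: "complex_of_real (cmod (\<Sum>j<n. C i j * x j)) * x i = complex_of_real s * z i + \<eta>"
      using stationary[OF i] unfolding C_mult_opt \<eta>_def by simp
    have "9/10 * n * cmod (x i - z i) \<le> s * cmod (x i - z i)"
      using s by (intro mult_right_mono) auto
    also have "\<dots> \<le> 2 * cmod \<eta>"
      by (rule norm_unit_diff_le[OF xz _ _ eq]) (auto simp: s_def)
    also have "2 * cmod \<eta> = 2 * \<sigma> * cmod (\<Sum>j<n. M i j * x j)"
      using \<sigma> by (simp add: \<eta>_def norm_mult)
    also have "\<dots> \<le> 2 * \<sigma> * (5/2 * sqrt (real n * ln n) + 48 * \<sigma> * sqrt n)"
      using noise_row_bound[OF i] \<sigma> by (intro mult_left_mono) auto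
    also have "\<dots> = sqrt n * (5 * (sqrt (ln n) * \<sigma>) + 96 * \<sigma>\<^sup>2)"
      by (simp add: real_sqrt_mult power2_eq_square algebra_simps)
    \<comment> \<open>The factor 9/10 from the bound on \<open>s\<close> leaves 5.4 against 5 and
      156.6 against 96.\<close>
    also have "\<dots> \<le> sqrt n * (9/10 * (6 * (sqrt (ln n) + 29 * \<sigma>) * \<sigma>))"
    proof (rule mult_left_mono)
      have "0 \<le> sqrt (ln n) * \<sigma>" "0 \<le> \<sigma>\<^sup>2" using lnn \<sigma> by auto
      moreover have "9/10 * (6 * (sqrt (ln n) + 29 * \<sigma>) * \<sigma>) = 54/10 * (sqrt (ln n) * \<sigma>) + 1566/10 * \<sigma>\<^sup>2"
        by (simp add: power2_eq_square algebra_simps)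
      ultimately show "5 * (sqrt (ln n) * \<sigma>) + 96 * \<sigma>\<^sup>2 \<le> 9/10 * (6 * (sqrt (ln n) + 29 * \<sigma>) * \<sigma>)"
        by linarith
    qed simp
    finally have "sqrt n * (sqrt n * cmod (x i - z i)) \<le> sqrt n * (6 * (sqrt (ln n) + 29 * \<sigma>) * \<sigma>)"
      unfolding mult.assoc[symmetric] sqrt_dimension(1) by (simp add: algebra_simps)
    then show ?thesis
      using sn by (simp add: pos_le_divide_eq mult.commute)
  qed
qed

text \<open>Margin of the certificate, estimated in powers of r = n^(1/4). After moving the deficit
  72 \<sigma>^2 of \<open>s\<close> to the left, the terms amount to roughly n/2 at most: 2/27,
  2/27, 5/24 and 4/27 of n.\<close>

lemma dual_gap_positive:
  assumes \<sigma>': "\<sigma> \<le> real n powr (1/4) / 18"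
  shows "144 * \<sigma>\<^sup>2 + 4 * \<sigma> * sqrt n + \<sigma> * (5/2 * sqrt (real n * ln n) + 48 * \<sigma> * sqrt n) < s"
proof -
  define r where "r = real n powr (1/4)"
  have r2: "r\<^sup>2 = sqrt n"
    using n by (simp add: r_def powr_half_sqrt[symmetric] powr_powr flip: powr_numeral)
  have r0: "r > 0" using n by (simp add: r_def)
  have r4: "r\<^sup>2 * r\<^sup>2 = real n" using r2 by simp
  have r3: "r \<ge> 3"
    by (rule power2_le_imp_le) (use r2 sqrt_dimension(2) r0 in auto)
  have \<sigma>2: "\<sigma>\<^sup>2 \<le> r\<^sup>2 / 324"
    using power_mono[OF \<sigma>'[folded r_def] \<sigma>, of 2] by (simp add: power_divide)
  \<comment> \<open>From ln n <= 2 sqrt n = 2 r^2 and 2 <= 9/4.\<close>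
  have ln: "sqrt (real n * ln n) \<le> 3/2 * (r\<^sup>2 * r)"
  proof (rule real_le_lsqrt)
    have "real n * ln n \<le> real n * (2 * sqrt n)"
      using n by (intro mult_left_mono ln_le_two_sqrt) auto
    also have "\<dots> = 2 * (r\<^sup>2 * r)\<^sup>2"
      unfolding r2[symmetric] r4[symmetric] by (simp add: power2_eq_square)
    also have "\<dots> \<le> (3/2 * (r\<^sup>2 * r))\<^sup>2"
      unfolding power_mult_distrib by (intro mult_right_mono) (auto simp: power2_eq_square)
    finally show "real n * ln n \<le> (3/2 * (r\<^sup>2 * r))\<^sup>2" .
  qed (use r0 in auto)
  have 1: "\<sigma> * sqrt (real n * ln n) \<le> (r / 18) * (3/2 * (r\<^sup>2 * r))"
    using \<sigma>' ln n r0 by (intro mult_mono) (auto simp: r_def)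
  have 2: "\<sigma>\<^sup>2 * sqrt n \<le> (r\<^sup>2 / 324) * r\<^sup>2"
    using \<sigma>2 r2 by (intro mult_mono) auto
  have 3: "\<sigma> * sqrt n \<le> (r / 18) * r\<^sup>2"
    using \<sigma>' r2 r0 by (intro mult_mono) (auto simp: r_def)
  have r34: "3 * (r * r\<^sup>2) \<le> real n" "9 * r\<^sup>2 \<le> real n" "real n > 0"
  proof -
    have "3 * (r * r\<^sup>2) \<le> r * (r * r\<^sup>2)"
      using r3 r0 by (intro mult_right_mono) auto
    also have "\<dots> = real n"
      unfolding r4[symmetric] by (simp add: power2_eq_square)
    finally show "3 * (r * r\<^sup>2) \<le> real n" .
    show "9 * r\<^sup>2 \<le> real n"
      using sqrt_dimension(3) r2 zero_le_power2[of r] by linarith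
    show "real n > 0" using n by simp
  qed
  have e: "144 * \<sigma>\<^sup>2 + 4 * \<sigma> * sqrt n + \<sigma> * (5/2 * sqrt (real n * ln n) + 48 * \<sigma> * sqrt n)
     = 144 * \<sigma>\<^sup>2 + 4 * (\<sigma> * sqrt n) + 5/2 * (\<sigma> * sqrt (real n * ln n)) + 48 * (\<sigma>\<^sup>2 * sqrt n)"
    by (simp add: power2_eq_square algebra_simps)
  have h: "(r / 18) * (3/2 * (r\<^sup>2 * r)) = 3/36 * real n" "(r\<^sup>2 / 324) * r\<^sup>2 = real n / 324"
    "(r / 18) * r\<^sup>2 = (r * r\<^sup>2) / 18"
    unfolding r4[symmetric] by (simp_all add: power2_eq_square)
  show ?thesis
    using correlation_lower_bound 1 2 3 r34 \<sigma>2 unfolding e h by linarith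
qed

text \<open>On the complement of \<open>x\<close> the signal nearly disappears: z^* u = - (x - z)^*
  u has modulus at most 12 \<sigma> times the norm of \<open>u\<close>. The multipliers stay above s
  - \<sigma> R, and \<open>dual_gap_positive\<close> compares the two.\<close>

lemma sdp_tight:
  assumes \<sigma>': "\<sigma> \<le> real n powr (1/4) / 18"
  shows "sdp_unique_solution n C (\<lambda>i j. x i * cnj (x j))"
proof (rule sdp_unique_solution_of_dual_certificate[OF _ hermitian_C unimod_opt stationary])
  show "n > 0" using n by simp
  define R where "R = 5/2 * sqrt (real n * ln n) + 48 * \<sigma> * sqrt n"
  fix u assume o: "cinner n x u = 0" and u: "norm_sq n u > 0"
  have \<mu>: "s - \<sigma> * R \<le> cmod (\<Sum>j<n. C i j * x j)" if "i < n" for i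
  proof -
    have "cmod (z i) = 1" using z that by (simp add: unimod_def)
    then have "s - cmod (complex_of_real \<sigma> * (\<Sum>j<n. M i j * x j)) \<le> cmod (\<Sum>j<n. C i j * x j)"
      unfolding C_mult_opt
      using norm_diff_ineq[of "complex_of_real s * z i" "complex_of_real \<sigma> * (\<Sum>j<n. M i j * x j)"]
      by (simp add: norm_mult s_def)
    moreover have "cmod (complex_of_real \<sigma> * (\<Sum>j<n. M i j * x j)) \<le> \<sigma> * R"
      using mult_left_mono[OF noise_row_bound[OF that] \<sigma>] \<sigma> by (simp add: norm_mult R_def)
    ultimately show ?thesis by linarith
  qed
  have "cinner n z u = - cinner n (\<lambda>i. x i - z i) u"
    using o by (simp add: cinner_def left_diff_distrib sum_subtractf)
  then have "cmod (cinner n z u) \<le> sqrt (norm_sq n (\<lambda>i. x i - z i)) * sqrt (norm_sq n u)"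
    using cinner_bound[of n "\<lambda>i. x i - z i" u] by simp
  also have "\<dots> \<le> 12 * \<sigma> * sqrt (norm_sq n u)"
    by (intro mult_right_mono l2_error) auto
  finally have "(cmod (cinner n z u))\<^sup>2 \<le> (12 * \<sigma> * sqrt (norm_sq n u))\<^sup>2"
    by (intro power_mono) auto
  then have 1: "(cmod (cinner n z u))\<^sup>2 \<le> 144 * \<sigma>\<^sup>2 * norm_sq n u"
    by (simp add: power_mult_distrib)
  have 2: "\<sigma> * Re (qform n M u) \<le> \<sigma> * (4 * sqrt n * norm_sq n u)"
    using Mq[of u] \<sigma> by (intro mult_left_mono) auto
  have "Re (qform n C u) \<le> (144 * \<sigma>\<^sup>2 + 4 * \<sigma> * sqrt n) * norm_sq n u"
    unfolding C_def qform_signal_plus_noise using 1 2 by (simp add: algebra_simps)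
  also have "\<dots> < (s - \<sigma> * R) * norm_sq n u"
    using dual_gap_positive[OF \<sigma>'] u by (intro mult_strict_right_mono) (auto simp: R_def)
  also have "\<dots> \<le> (\<Sum>i<n. cmod (\<Sum>j<n. C i j * x j) * (cmod (u i))\<^sup>2)"
    unfolding norm_sq_def sum_distrib_left using \<mu> by (intro sum_mono mult_right_mono) auto
  finally show "Re (qform n C u) < (\<Sum>i<n. cmod (\<Sum>j<n. C i j * x j) * (cmod (u i))\<^sup>2)" .
qed auto

end

section \<open>Combining the noise event with the deterministic bounds\<close>

lemma hermitian_wigner_matrix: "hermitian_mat n (wigner_matrix w)"
  by (auto simp: hermitian_mat_def wigner_matrix_def)

text \<open>The probability is stated through a measurable event \<open>A\<close> on which the
  claims hold for all optimizers; measurability of the full set of favourable outcomes is a separate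
  question.\<close>

theorem theorem1:
  shows "\<exists>K::real. \<forall>n::nat. \<forall>\<sigma>::real. \<forall>z::nat \<Rightarrow> complex.
    n \<ge> 2 \<longrightarrow> \<sigma> \<ge> 0 \<longrightarrow> unimod n z \<longrightarrow>
    (\<exists>A \<in> sets (wigner_entries n).
       measure (wigner_entries n) A \<ge> 1 - K * real n powr (-5/4) \<and>
       (\<forall>w\<in>A. \<forall>x.
          (let C = (\<lambda>i j. z i * cnj (z j) + complex_of_real \<sigma> * wigner_matrix w i j) in
           is_global_opt n C x \<and> cinner n z x = complex_of_real (cmod (cinner n z x)) \<longrightarrow>
             (\<forall>i<n. cmod (x i - z i) \<le> 6 * (sqrt (ln (real n)) + 29 * \<sigma>) * \<sigma> / sqrt (real n)) \<and>
             sqrt (\<Sum>i<n. (cmod (x i - z i))\<^sup>2) \<le> 12 * \<sigma> \<and>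
             (\<sigma> \<le> real n powr (1/4) / 18 \<longrightarrow>
                sdp_unique_solution n C (\<lambda>i j. x i * cnj (x j))))))"
proof (intro exI[of _ "10000"] allI impI)
  fix n :: nat and \<sigma> :: real and z :: "nat \<Rightarrow> complex"
  assume n: "n \<ge> 2" and \<sigma>: "\<sigma> \<ge> 0" and z: "unimod n z"
  show "\<exists>A \<in> sets (wigner_entries n).
       measure (wigner_entries n) A \<ge> 1 - 10000 * real n powr (-5/4) \<and>
       (\<forall>w\<in>A. \<forall>x.
          (let C = (\<lambda>i j. z i * cnj (z j) + complex_of_real \<sigma> * wigner_matrix w i j) in
           is_global_opt n C x \<and> cinner n z x = complex_of_real (cmod (cinner n z x)) \<longrightarrow>
             (\<forall>i<n. cmod (x i - z i) \<le> 6 * (sqrt (ln (real n)) + 29 * \<sigma>) * \<sigma> / sqrt (real n)) \<and>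
             sqrt (\<Sum>i<n. (cmod (x i - z i))\<^sup>2) \<le> 12 * \<sigma> \<and>
             (\<sigma> \<le> real n powr (1/4) / 18 \<longrightarrow>
                sdp_unique_solution n C (\<lambda>i j. x i * cnj (x j)))))"
  proof (cases "n < 100")
    case True
    \<comment> \<open>The constant 10000 = 100^2 makes the claimed probability at most 0 in
      dimensions below 100, so the empty event suffices.\<close>
    have "real n powr (5/4) \<le> real n powr 2"
      using n by (intro powr_mono) auto
    also have "\<dots> \<le> 100 powr 2"
      using True by (intro powr_mono2) auto
    also have "\<dots> = 10000"
      by simp
    finally have "1 \<le> 10000 / real n powr (5/4)"
      using n by (subst pos_le_divide_eq) auto
    also have "\<dots> = 10000 * real n powr (-5/4)"
      using powr_minus_divide[of "real n" "5/4"] by simp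
    finally show ?thesis
      by (intro bexI[of _ "{}"]) auto
  next
    case False
    then have n100: "n \<ge> 100" by simp
    \<comment> \<open>This event depends on \<open>n\<close> and \<open>z\<close> but not on
      \<open>\<sigma>\<close>.\<close>
    obtain A where A: "A \<in> sets (wigner_entries n)"
      and prob: "measure (wigner_entries n) A \<ge> 1 - 8 * real n powr (-5/4)"
      and form: "\<And>w v. w \<in> A \<Longrightarrow> \<bar>wigner_form n w v\<bar> \<le> 4 * sqrt n * (\<Sum>i<n. (cmod (v i))\<^sup>2)"
      and row: "\<And>w i. w \<in> A \<Longrightarrow> i < n \<Longrightarrow> cmod (wigner_row n w z i) \<le> 5/2 * sqrt (real n * ln n)"
      using wigner_good_event[OF n z] by blast
    show ?thesis
      unfolding Let_def
    proof (intro bexI[OF _ A] conjI ballI allI impI)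
      show "1 - 10000 * real n powr (-5/4) \<le> measure (wigner_entries n) A"
        using prob powr_ge_zero[of "real n" "-5/4"] by linarith
      fix w x
      assume w: "w \<in> A" and opt: "is_global_opt n (\<lambda>i j. z i * cnj (z j) + complex_of_real \<sigma> * wigner_matrix w i j) x
        \<and> cinner n z x = complex_of_real (cmod (cinner n z x))"
      note M = hermitian_wigner_matrix[of n w]
      have diag: "wigner_matrix w i i = 0" if "i < n" for i
        by (simp add: wigner_matrix_def)
      have q: "\<bar>Re (qform n (wigner_matrix w) v)\<bar> \<le> 4 * sqrt n * norm_sq n v" for v
        using form[OF w] by (simp add: qform_wigner_matrix norm_sq_def)
      have r: "cmod (\<Sum>j<n. wigner_matrix w i j * z j) \<le> 5/2 * sqrt (real n * ln n)" if "i < n" for i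
        using row[OF w that] by (simp add: wigner_row_def)
      note det = n100 \<sigma> z M diag q r opt[THEN conjunct1] opt[THEN conjunct2]
      show "cmod (x i - z i) \<le> 6 * (sqrt (ln (real n)) + 29 * \<sigma>) * \<sigma> / sqrt (real n)" if "i < n" for i
        by (rule sup_error[OF det that])
      show "sqrt (\<Sum>i<n. (cmod (x i - z i))\<^sup>2) \<le> 12 * \<sigma>"
        using l2_error[OF det] by (simp add: norm_sq_def)
      show "sdp_unique_solution n (\<lambda>i j. z i * cnj (z j) + complex_of_real \<sigma> * wigner_matrix w i j) (\<lambda>i j. x i * cnj (x j))"
        if "\<sigma> \<le> real n powr (1/4) / 18"
        by (rule sdp_tight[OF det that])
    qed
  qed
qed

end
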